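(* Suppose $f\colon A\to B$ is a morphism of $A_\infty$-algebras over a field $\mathbb{K}$ and $m\ge2$. (i) If $\mathbf{a}=(a_{ij})_{0\le i,j\le m}\in\mathrm{Mat}^{(m+1)}_+(A)$ is a defining system of $\alpha_1,\dots,\alpha_m\in\mathrm{H}(A)$, then $F_{\mathbf{a}}(\mathbf{a})\in\mathrm{Mat}^{(m+1)}_+(B)$ is a defining system of $(f_1)_*\alpha_1,\dots,(f_1)_*\alpha_m\in\mathrm{H}(B)$, and $\mu^B(F_{\mathbf{a}}(\mathbf{a}))=f_1(\mu^A(\mathbf{a}))$. (ii) If $\mathbf{a}$ and $\mathbf{a}'$ are two equivalent defining systems, then so are $F_{\mathbf{a}}(\mathbf{a})$ and $F_{\mathbf{a}'}(\mathbf{a}')$.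
   Context: $A_\infty$-algebra: a $\mathbb{Z}$- or $\mathbb{Z}_2$-graded $\mathbb{K}$-vector space $A$ with graded multilinear maps $b_n\colon A^{\otimes n}\to A$ ($n\ge1$) of degree $1$ such that for each $n\ge1$, $\sum_{r,t\ge0,\,s\ge1,\,r+s+t=n}b_{r+1+t}\circ(1^{\otimes r}\otimes b_s\otimes1^{\otimes t})=0$ (Koszul sign rule $(f\otimes g)(x\otimes y)=(-1)^{|g||x|}f(x)\otimes g(y)$). $\mathrm{H}(A)$ is the cohomology of $(A,b_1)$. A bar denotes $\bar a=(-1)^{|a|}a$ for homogeneous $a$, extended linearly and entrywise to matrices. A morphism $f\colon A\to B$ is a family of multilinear maps $f_n\colon A^{\otimes n}\to B$ ($n\ge1$) of degree $0$ with, for each $n\ge1$, $$\sum_{r,t\ge0,\,s\ge1,\,r+s+t=n}f_{r+1+t}\circ(1^{\otimes r}\otimes b^A_s\otimes1^{\otimes t})=\sum_{r\ge1;\,i_1,\dots,i_r>0;\,i_1+\cdots+i_r=n}b^B_r\circ(f_{i_1}\otimes\cdots\otimes f_{i_r}).$$ In particular $f_1\colon(A,b_1^A)\to(B,b_1^B)$ is a cochain map. $\mathrm{Mat}^{(m+1)}_+(A)$ is the space of strictly upper-triangular matrices $\mathbf{a}=(a_{ij})_{0\le i,j\le m}$ with entries in $A$. The product $\odot$ of matrices is $(\mathbf{a}\odot\mathbf{b})_{ij}=\sum_ka_{ik}\otimes b_{kj}$ (no signs); $b_n$, $f_n$ act component-wise on matrices with entries in $A^{\otimes n}$. For $\mathbf{a}\in\mathrm{Mat}^{(m+1)}_+(A)$,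 $\partial_{\mathbf{a}}\mathbf{a}=\sum_{n\ge1}b_n(\underbrace{\mathbf{a}\odot\cdots\odot\mathbf{a}}_n)$ and $F_{\mathbf{a}}(\mathbf{a})=\sum_{n\ge1}f_n(\underbrace{\mathbf{a}\odot\cdots\odot\mathbf{a}}_n)$ (finite sums), and $\mathbf{a}\approx\mathbf{a}'$ means $a_{ij}=a'_{ij}$ for all $(i,j)\ne(0,m)$. For $m\ge2$, $\mathbf{a}$ is a defining system for $\alpha_1,\dots,\alpha_m\in\mathrm{H}(A)$ if $\partial_{\mathbf{a}}\mathbf{a}\approx0$ and each $\alpha_i$ is represented by the (then closed) element $a_{i-1,i}$. Put $\mu(\mathbf{a})=(\partial_{\mathbf{a}}\mathbf{a})_{0m}$ (written $\mu^A$, $\mu^B$ to indicate the algebra). Two defining systems $\mathbf{a},\mathbf{a}'$ of $\alpha_1,\dots,\alpha_m$ are equivalent if there is $\mathbf{c}\in\mathrm{Mat}^{(m+1)}_+(A)$ such that $$\mathbf{a}'-\mathbf{a}\approx\sum_{r,t\ge0}b_{r+1+t}(\underbrace{\overline{\mathbf{a}'}\odot\cdots\odot\overline{\mathbf{a}'}}_r\odot\,\mathbf{c}\odot\underbrace{\mathbf{a}\odot\cdots\odot\mathbf{a}}_t).$$ *)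

theory Defs
  imports Complex_Main "HOL-Library.Multiset" "HOL-Library.Groups_Big_Fun" "HOL-Library.Z2"
begin

section \<open>Graded vector spaces\<close>

text \<open>
  The class of grading groups contains exactly the rings isomorphic to the integers or to the
  integers mod 2 (both instances are given below), so that both kinds of grading are covered by a
  single type variable. In such a ring, \<^prop>\<open>2 dvd d\<close> says that the degree \<open>d\<close> is even.
\<close>

class grading_group = comm_ring_1 +
  assumes generated_by_one: "\<exists>k::int. x = of_int k"
    and char_zero_or_two: "(1 + 1 = 0) \<or> (\<forall>n::nat. of_nat (Suc n) \<noteq> 0)"

instance int :: grading_group
proof
  show "\<exists>k::int. x = of_int k" for x :: int
    by (rule exI[of _ x]) simp
  show "(1 + 1 = (0::int)) \<or> (\<forall>n::nat. of_nat (Suc n) \<noteq> (0::int))"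
    by (intro disjI2 allI) simp
qed

instance bit :: grading_group
proof
  show "\<exists>k::int. x = of_int k" for x :: bit
    by (cases x) (auto intro: exI[of _ 0] exI[of _ 1])
  show "(1 + 1 = (0::bit)) \<or> (\<forall>n::nat. of_nat (Suc n) \<noteq> (0::bit))"
    by simp
qed

definition homog_decomp :: "('g \<Rightarrow> 'a::ab_group_add set) \<Rightarrow> 'a \<Rightarrow> ('g \<Rightarrow> 'a) \<Rightarrow> bool" where
  "homog_decomp V x c \<longleftrightarrow> (\<forall>d. c d \<in> V d) \<and> finite {d. c d \<noteq> 0} \<and> Sum_any c = x"

locale graded_vector_space = vector_space scale
  for scale :: "'k::field \<Rightarrow> 'a::ab_group_add \<Rightarrow> 'a" +
  fixes V :: "'g::grading_group \<Rightarrow> 'a set"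
  assumes subspace_component: "subspace (V d)"
    and direct_sum: "\<exists>!c. homog_decomp V x c"

definition homog_component :: "('g \<Rightarrow> 'a::ab_group_add set) \<Rightarrow> 'a \<Rightarrow> 'g \<Rightarrow> 'a" where
  "homog_component V x = (THE c. homog_decomp V x c)"

definition sign_act :: "'g::grading_group \<Rightarrow> 'a::ab_group_add \<Rightarrow> 'a"
  \<comment> \<open>\<open>(-1)^d x\<close>\<close>
  where "sign_act d x = (if 2 dvd d then x else - x)"

definition bar :: "('g::grading_group \<Rightarrow> 'a::ab_group_add set) \<Rightarrow> 'a \<Rightarrow> 'a" where
  "bar V x = Sum_any (\<lambda>d. sign_act d (homog_component V x d))"


section \<open>$A_\infty$-algebras and their morphisms\<close>

text \<open>
  A family of multilinear maps \<open>\<phi>\<^sub>n : A\<^sup>\<otimes>\<^sup>n \<rightarrow> B\<close> (\<open>n \<ge> 1\<close>) is encoded as one function on lists, the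
  value on \<open>[x\<^sub>1, \<dots>, x\<^sub>n]\<close> being \<open>\<phi>\<^sub>n(x\<^sub>1 \<otimes> \<dots> \<otimes> x\<^sub>n)\<close>. The value on the empty list is irrelevant.
\<close>

definition multilinear ::
  "('k \<Rightarrow> 'a::ab_group_add \<Rightarrow> 'a) \<Rightarrow> ('k \<Rightarrow> 'b::ab_group_add \<Rightarrow> 'b) \<Rightarrow> ('a list \<Rightarrow> 'b) \<Rightarrow> bool" where
  "multilinear sA sB \<phi> \<longleftrightarrow>
     (\<forall>us vs x y. \<phi> (us @ (x + y) # vs) = \<phi> (us @ x # vs) + \<phi> (us @ y # vs)) \<and>
     (\<forall>us vs k x. \<phi> (us @ sA k x # vs) = sB k (\<phi> (us @ x # vs)))"

definition homogeneous_list :: "('g \<Rightarrow> 'a set) \<Rightarrow> 'a list \<Rightarrow> 'g list \<Rightarrow> bool" where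
  "homogeneous_list V xs ds \<longleftrightarrow> list_all2 (\<lambda>x d. x \<in> V d) xs ds"

definition of_degree ::
  "('g::grading_group \<Rightarrow> 'a set) \<Rightarrow> ('g \<Rightarrow> 'b set) \<Rightarrow> 'g \<Rightarrow> ('a list \<Rightarrow> 'b) \<Rightarrow> bool" where
  "of_degree VA VB e \<phi> \<longleftrightarrow>
     (\<forall>xs ds. xs \<noteq> [] \<and> homogeneous_list VA xs ds \<longrightarrow> \<phi> xs \<in> VB (sum_list ds + e))"

text \<open>
  The value of \<open>\<Sum>\<^bsub>r+s+t=n\<^esub> \<phi>\<^bsub>r+1+t\<^esub> \<circ> (1\<^sup>\<otimes>\<^sup>r \<otimes> b\<^sub>s \<otimes> 1\<^sup>\<otimes>\<^sup>t)\<close> on \<open>x\<^sub>1 \<otimes> \<dots> \<otimes> x\<^sub>n\<close> with \<open>x\<^sub>i\<close> of degree \<open>d\<^sub>i\<close>. As \<open>b\<^sub>s\<close> has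
  degree 1, moving it past \<open>x\<^sub>1, \<dots>, x\<^sub>r\<close> yields the Koszul sign \<open>(-1)^(d\<^sub>1 + \<dots> + d\<^sub>r)\<close>.
\<close>

definition insertion_sum ::
  "('a list \<Rightarrow> 'b::ab_group_add) \<Rightarrow> ('a list \<Rightarrow> 'a) \<Rightarrow> 'a list \<Rightarrow> 'g::grading_group list \<Rightarrow> 'b" where
  "insertion_sum \<phi> b xs ds =
     (\<Sum>(r, s, t) \<in> {(r, s, t). r + s + t = length xs \<and> 1 \<le> s}.
        sign_act (sum_list (take r ds))
          (\<phi> (take r xs @ [b (take s (drop r xs))] @ drop (r + s) xs)))"

text \<open>
  By multilinearity it suffices to impose the structure equations on homogeneous arguments.
\<close>

locale A_infinity_algebra = graded_vector_space scale V
  for scale :: "'k::field \<Rightarrow> 'a::ab_group_add \<Rightarrow> 'a" and V :: "'g::grading_group \<Rightarrow> 'a set" +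
  fixes b :: "'a list \<Rightarrow> 'a"
  assumes b_multilinear: "multilinear scale scale b"
    and b_degree: "of_degree V V 1 b"
    and b_relation: "\<lbrakk>xs \<noteq> []; homogeneous_list V xs ds\<rbrakk> \<Longrightarrow> insertion_sum b b xs ds = 0"

fun blocks :: "nat list \<Rightarrow> 'a list \<Rightarrow> 'a list list" where
  "blocks [] xs = []"
| "blocks (i # is) xs = take i xs # blocks is (drop i xs)"

text \<open>
  The right-hand side below involves no signs because the \<open>f\<^sub>i\<close> have degree 0.
\<close>

locale A_infinity_morphism =
  A: A_infinity_algebra scaleA VA bA + B: A_infinity_algebra scaleB VB bB
  for scaleA :: "'k::field \<Rightarrow> 'a::ab_group_add \<Rightarrow> 'a" and VA :: "'g::grading_group \<Rightarrow> 'a set"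
    and bA :: "'a list \<Rightarrow> 'a"
    and scaleB :: "'k \<Rightarrow> 'b::ab_group_add \<Rightarrow> 'b" and VB :: "'g \<Rightarrow> 'b set"
    and bB :: "'b list \<Rightarrow> 'b" +
  fixes f :: "'a list \<Rightarrow> 'b"
  assumes f_multilinear: "multilinear scaleA scaleB f"
    and f_degree: "of_degree VA VB 0 f"
    and f_relation: "\<lbrakk>xs \<noteq> []; homogeneous_list VA xs ds\<rbrakk> \<Longrightarrow>
      insertion_sum f bA xs ds =
        (\<Sum>is \<in> {is. (\<forall>i \<in> set is. 0 < i) \<and> sum_list is = length xs}. bB (map f (blocks is xs)))"


section \<open>Cohomology\<close>

definition cohom_rel :: "('a::ab_group_add list \<Rightarrow> 'a) \<Rightarrow> ('a \<times> 'a) set" where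
  "cohom_rel b = {(x, y). b [x] = 0 \<and> b [y] = 0 \<and> (\<exists>z. y - x = b [z])}"

definition cohomology :: "('a::ab_group_add list \<Rightarrow> 'a) \<Rightarrow> 'a set set" where
  "cohomology b = {x. b [x] = 0} // cohom_rel b"

definition cohom_map ::
  "('b::ab_group_add list \<Rightarrow> 'b) \<Rightarrow> ('a list \<Rightarrow> 'b) \<Rightarrow> 'a set \<Rightarrow> 'b set"
  \<comment> \<open>\<open>(f\<^sub>1)\<^sub>*\<close>: a class, being the set of its representatives, is sent to the class of their images\<close>
  where "cohom_map bB f \<alpha> = cohom_rel bB `` ((\<lambda>x. f [x]) ` \<alpha>)"


section \<open>Matrices\<close>

text \<open>
  A matrix with index range \<open>0, \<dots>, m\<close> is a function on all pairs of natural numbers; membership in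
  \<open>Mat_plus m\<close> forces the entries outside this range to vanish.
\<close>

type_synonym 'a mat = "nat \<Rightarrow> nat \<Rightarrow> 'a"

definition Mat_plus :: "nat \<Rightarrow> 'a::zero mat set" where
  "Mat_plus m = {a. \<forall>i j. \<not> (i < j \<and> j \<le> m) \<longrightarrow> a i j = 0}"

definition bar_mat :: "('g::grading_group \<Rightarrow> 'a::ab_group_add set) \<Rightarrow> 'a mat \<Rightarrow> 'a mat" where
  "bar_mat V a = (\<lambda>i j. bar V (a i j))"

text \<open>
  An element of a tensor power of \<open>A\<close> is represented by a formal sum of pure tensors: the multiset of
  words \<open>{# [x\<^sub>1, \<dots>, x\<^sub>n], [y\<^sub>1, \<dots>, y\<^sub>n], \<dots> #}\<close> stands for
  \<open>x\<^sub>1 \<otimes> \<dots> \<otimes> x\<^sub>n + y\<^sub>1 \<otimes> \<dots> \<otimes> y\<^sub>n + \<dots>\<close>. Representatives of the same tensor need not be identified,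
  since they are only ever used as arguments of multilinear maps (via \<open>on_tensor\<close>).
\<close>

type_synonym 'a tensor = "'a list multiset"

definition pure_mat :: "'a mat \<Rightarrow> 'a tensor mat" where
  "pure_mat a = (\<lambda>i j. {#[a i j]#})"

definition odot :: "nat \<Rightarrow> 'a tensor mat \<Rightarrow> 'a tensor mat \<Rightarrow> 'a tensor mat" where
  "odot m S T = (\<lambda>i j. \<Sum>k\<le>m. \<Sum>u\<in>#S i k. {#u @ v. v \<in># T k j#})"

definition odot_one :: "'a tensor mat"
  \<comment> \<open>the identity matrix, with entries in the tensor power of exponent 0\<close>
  where "odot_one = (\<lambda>i j. if i = j then {#[]#} else {#})"

definition odots :: "nat \<Rightarrow> 'a mat list \<Rightarrow> 'a tensor mat"
  \<comment> \<open>\<open>odots m [a\<^sub>1, \<dots>, a\<^sub>n] = a\<^sub>1 \<odot> \<dots> \<odot> a\<^sub>n\<close>\<close>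
  where "odots m as = foldr (\<lambda>a T. odot m (pure_mat a) T) as odot_one"

definition on_tensor :: "('a list \<Rightarrow> 'b::comm_monoid_add) \<Rightarrow> 'a tensor mat \<Rightarrow> 'b mat"
  \<comment> \<open>component-wise action of a multilinear map\<close>
  where "on_tensor \<phi> T = (\<lambda>i j. \<Sum>w\<in>#T i j. \<phi> w)"

definition power_sum :: "nat \<Rightarrow> ('a list \<Rightarrow> 'b::comm_monoid_add) \<Rightarrow> 'a mat \<Rightarrow> 'b mat"
  \<comment> \<open>\<open>\<Sum>\<^bsub>n\<ge>1\<^esub> \<phi>\<^sub>n(a \<odot> \<dots> \<odot> a)\<close>, only finitely many summands being nonzero for \<open>a \<in> Mat_plus m\<close>\<close>
  where "power_sum m \<phi> a = (\<lambda>i j. Sum_any (\<lambda>n. on_tensor \<phi> (odots m (replicate (Suc n) a)) i j))"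

definition del_mat :: "nat \<Rightarrow> ('a::ab_group_add list \<Rightarrow> 'a) \<Rightarrow> 'a mat \<Rightarrow> 'a mat"
  \<comment> \<open>\<open>\<partial>\<^sub>a a\<close>\<close>
  where "del_mat m b a = power_sum m b a"

definition F_mat :: "nat \<Rightarrow> ('a list \<Rightarrow> 'b::ab_group_add) \<Rightarrow> 'a mat \<Rightarrow> 'b mat"
  \<comment> \<open>\<open>F\<^sub>a(a)\<close>\<close>
  where "F_mat m f a = power_sum m f a"

definition approx_mat :: "nat \<Rightarrow> 'a mat \<Rightarrow> 'a mat \<Rightarrow> bool" where
  "approx_mat m a a' \<longleftrightarrow> (\<forall>i\<le>m. \<forall>j\<le>m. (i, j) \<noteq> (0, m) \<longrightarrow> a i j = a' i j)"


section \<open>Defining systems\<close>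

definition defining_system ::
  "nat \<Rightarrow> ('a::ab_group_add list \<Rightarrow> 'a) \<Rightarrow> (nat \<Rightarrow> 'a set) \<Rightarrow> 'a mat \<Rightarrow> bool"
  \<comment> \<open>only the classes \<open>\<alpha> 1, \<dots>, \<alpha> m\<close> matter\<close>
  where "defining_system m b \<alpha> a \<longleftrightarrow>
     a \<in> Mat_plus m \<and> approx_mat m (del_mat m b a) (\<lambda>i j. 0) \<and>
     (\<forall>i \<in> {1..m}. \<alpha> i \<in> cohomology b \<and> a (i - 1) i \<in> \<alpha> i)"

definition mu :: "nat \<Rightarrow> ('a::ab_group_add list \<Rightarrow> 'a) \<Rightarrow> 'a mat \<Rightarrow> 'a" where
  "mu m b a = del_mat m b a 0 m"

definition equivalent_defining_systems ::
  "nat \<Rightarrow> ('g::grading_group \<Rightarrow> 'a::ab_group_add set) \<Rightarrow> ('a list \<Rightarrow> 'a) \<Rightarrow>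
     (nat \<Rightarrow> 'a set) \<Rightarrow> 'a mat \<Rightarrow> 'a mat \<Rightarrow> bool" where
  "equivalent_defining_systems m V b \<alpha> a a' \<longleftrightarrow>
     defining_system m b \<alpha> a \<and> defining_system m b \<alpha> a' \<and>
     (\<exists>c \<in> Mat_plus m.
        approx_mat m (\<lambda>i j. a' i j - a i j)
          (\<lambda>i j. Sum_any (\<lambda>(r, t).
             on_tensor b (odots m (replicate r (bar_mat V a') @ [c] @ replicate t a)) i j)))"

end

theory Submission
  imports Defs
begin

text \<open>
  An entry \<open>(i, j)\<close> of a power \<open>a \<odot> \<dots> \<odot> a\<close> of a strictly upper triangular matrix is a sum over
  increasing paths from \<open>i\<close> to \<open>j\<close>, each path contributing the word of its edge labels. Hence
  \<open>\<partial>\<^sub>a a\<close> and \<open>F\<^sub>a(a)\<close> are path sums, and an entry of \<open>\<partial>\<close> of \<open>F\<^sub>a(a)\<close> is a sum over coarse paths each of whose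
  edges is refined to a fine path. Such a pair is the same thing as a fine path with a composition
  of its length, so the relations of the morphism can be applied to every fine path separately. On the other side of the
  relations one finds fine paths with a marked segment; collecting the segments with given
  end points turns this into a sum over paths with one edge labelled by an entry of \<open>\<partial>\<^sub>a a\<close>.
  In symbols (lemma \<open>path_sum_morphism\<close>):
  \<open>\<Sum>\<^sub>n b\<^sup>B\<^sub>n(F\<^sub>a(a), \<dots>, F\<^sub>a(a)) = \<Sum>\<^sub>r\<^sub>,\<^sub>t f(bar a, \<dots>, bar a, \<partial>\<^sub>a a, a, \<dots>, a)\<close>,
  with \<open>r\<close> entries before and \<open>t\<close> entries after \<open>\<partial>\<^sub>a a\<close>.

  For a defining system the only entry of \<open>\<partial>\<^sub>a a\<close> that can be nonzero is the corner \<open>(0, m)\<close>,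
  and the edge from \<open>0\<close> to \<open>m\<close> lies on no longer path. So the right-hand side is \<open>f\<^sub>1\<close> of the
  corner, which is part (i).

  For part (ii) the same identity is applied to the block matrix with diagonal blocks \<open>bar a'\<close> and
  \<open>a\<close> and upper right block \<open>c\<close>. A path from the first to the second block crosses exactly once, so
  the off-diagonal block of a path sum is exactly a sum over \<open>(r, t)\<close> as in the definition of
  equivalence. In particular the image matrix has diagonal blocks \<open>bar F(a')\<close> and \<open>F(a)\<close>, where
  \<open>F(a)\<close> abbreviates \<open>F\<^sub>a(a)\<close>, and its
  off-diagonal block \<open>C = \<Sum> f(bar a', \<dots>, bar a', c, a, \<dots>, a)\<close> is the witness for the equivalence of
  \<open>F(a)\<close> and \<open>F(a')\<close>. On the right-hand side the diagonal blocks of \<open>\<partial>\<close> contribute nothing, the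
  crossing edges other than \<open>(0, m)\<close> carry \<open>a' - a\<close>, and the sum of \<open>f(a', \<dots>, a', a' - a, a, \<dots>, a)\<close> telescopes to
  \<open>F(a') - F(a)\<close>.

  Koszul signs are handled once: extending the structure relations from homogeneous to arbitrary
  words replaces the sign in front of the inserted \<open>b\<^sub>s\<close> by a bar on each of the preceding entries.
\<close>


section \<open>Parity in a grading group\<close>

text \<open>
  The degree of \<open>b\<close> is odd. Were 1 divisible by 2, an odd integer would vanish in the grading group,
  which is impossible in characteristic 2 as well as in characteristic 0.
\<close>

lemma two_not_dvd_one: "\<not> (2::'g::grading_group) dvd 1"
proof
  assume "(2::'g) dvd 1"
  then obtain c :: 'g where c: "1 = 2 * c" by (auto simp: dvd_def)
  obtain k :: int where k: "c = of_int k" using generated_by_one by blast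
  from char_zero_or_two[where 'a='g] show False
  proof
    assume "(1::'g) + 1 = 0"
    then have "(2::'g) = 0" by simp
    with c show False by simp
  next
    assume nz: "\<forall>n::nat. of_nat (Suc n) \<noteq> (0::'g)"
    have "of_int (2 * k - 1) = (0::'g)" using c k by simp
    then have "of_nat (nat \<bar>2 * k - 1\<bar>) = (0::'g)"
      by (cases "2 * k - 1 \<ge> 0") (simp_all add: of_nat_nat)
    moreover have "2 * k - 1 \<noteq> 0" by presburger
    then obtain n where "nat \<bar>2 * k - 1\<bar> = Suc n" by (cases "nat \<bar>2 * k - 1\<bar>") auto
    ultimately show False using nz by metis
  qed
qed

lemma two_dvd_add_iff: "(2::'g::grading_group) dvd d + e \<longleftrightarrow> (2 dvd d \<longleftrightarrow> 2 dvd e)"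
proof -
  have cases: "2 dvd x \<or> 2 dvd x - 1" for x :: 'g
  proof -
    obtain k :: int where k: "x = of_int k" using generated_by_one by blast
    have "2 dvd k \<or> 2 dvd k - 1" by presburger
    then show ?thesis
      unfolding k by (auto simp: dvd_def) (metis of_int_1 of_int_diff of_int_mult of_int_numeral)
  qed
  have odd: "\<not> 2 dvd x" if "2 dvd x - 1" for x :: 'g
    using that two_not_dvd_one dvd_diff[of 2 x "x - 1"] by auto
  show ?thesis
  proof (cases "2 dvd d")
    case True
    then show ?thesis by (simp add: dvd_add_right_iff)
  next
    case False
    then have d: "2 dvd d - 1" using cases by blast
    show ?thesis
    proof (cases "2 dvd e")
      case True
      then show ?thesis by (simp add: dvd_add_left_iff)
    next
      case e: False
      then have "2 dvd e - 1" using cases by blast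
      with d have "2 dvd (d - 1) + (e - 1) + 2" by (intro dvd_add) auto
      then show ?thesis using False e by simp
    qed
  qed
qed

lemma sign_act_add: "sign_act (d + e) x = sign_act d (sign_act e x)"
  by (auto simp: sign_act_def two_dvd_add_iff)

lemma sign_act_0 [simp]: "sign_act 0 x = x"
  by (simp add: sign_act_def)

lemma sign_act_one: "sign_act (1::'g::grading_group) x = - x"
  by (simp add: sign_act_def two_not_dvd_one)

lemma sign_act_plus: "sign_act d (x + y) = sign_act d x + sign_act d y"
  by (simp add: sign_act_def)

lemma sign_act_involution: "sign_act d (sign_act d x) = x"
  by (simp add: sign_act_def)


section \<open>Additive functions of words\<close>

text \<open>
  Additivity in each letter passes to signed sums, to inserted bars and to sums over positions in
  the word, and a function with this property is determined by its values on homogeneous words.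
\<close>

definition multiadditive :: "('a::ab_group_add list \<Rightarrow> 'b::ab_group_add) \<Rightarrow> bool" where
  "multiadditive \<phi> \<longleftrightarrow> (\<forall>us vs x y. \<phi> (us @ (x + y) # vs) = \<phi> (us @ x # vs) + \<phi> (us @ y # vs))"

lemma multilinear_imp_multiadditive: "multilinear sA sB \<phi> \<Longrightarrow> multiadditive \<phi>"
  by (simp add: multilinear_def multiadditive_def)

lemma multiadditive_add:
  "multiadditive \<phi> \<Longrightarrow> \<phi> (us @ (x + y) # vs) = \<phi> (us @ x # vs) + \<phi> (us @ y # vs)"
  by (simp add: multiadditive_def)

lemma multiadditive_Cons:
  assumes "multiadditive \<phi>" shows "multiadditive (\<lambda>w. \<phi> (x # w))"
  using multiadditive_add[OF assms, of "x # us" for us] by (simp add: multiadditive_def)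

lemma multiadditive_zero: "multiadditive \<phi> \<Longrightarrow> \<phi> (us @ 0 # vs) = 0"
  using multiadditive_add[of \<phi> us 0 0 vs] by simp

lemma multiadditive_minus:
  assumes "multiadditive \<phi>" shows "\<phi> (us @ (- x) # vs) = - \<phi> (us @ x # vs)"
  using multiadditive_add[OF assms, of us "- x" x vs] multiadditive_zero[OF assms, of us vs]
  by (simp add: eq_neg_iff_add_eq_0)

lemma multiadditive_diff:
  assumes "multiadditive \<phi>"
  shows "\<phi> (us @ (x - y) # vs) = \<phi> (us @ x # vs) - \<phi> (us @ y # vs)"
  using multiadditive_add[OF assms, of us x "- y" vs] multiadditive_minus[OF assms] by simp

lemma multiadditive_sum:
  assumes "multiadditive \<phi>"
  shows "\<phi> (us @ (\<Sum>p\<in>P. g p) # vs) = (\<Sum>p\<in>P. \<phi> (us @ g p # vs))"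
  by (induction P rule: infinite_finite_induct)
    (simp_all add: multiadditive_zero[OF assms] multiadditive_add[OF assms])

lemma multiadditive_sign_act:
  "multiadditive \<phi> \<Longrightarrow> \<phi> (us @ sign_act d x # vs) = sign_act d (\<phi> (us @ x # vs))"
  by (simp add: sign_act_def multiadditive_minus)

lemma multiadditive_map:
  assumes "multiadditive \<phi>" and "\<And>x y. h (x + y) = h x + h y"
  shows "multiadditive (\<lambda>xs. \<phi> (map h xs))"
  using assms by (simp add: multiadditive_def)

lemma list_all2_Cons_image:
  "{ps. list_all2 (\<lambda>p e. p \<in> P e) ps (e # q)} =
    (\<lambda>(p, ps). p # ps) ` (P e \<times> {ps. list_all2 (\<lambda>p e. p \<in> P e) ps q})"
  by (auto simp: list_all2_Cons2 image_iff)

text \<open>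
  Distributivity of \<open>\<phi>\<close> over a word of sums: the words \<open>ps\<close> below choose one summand for each letter
  of \<open>q\<close>.
\<close>

lemma multiadditive_expand_sums:
  assumes \<phi>: "multiadditive \<phi>"
  shows "\<phi> (us @ map (\<lambda>e. \<Sum>p\<in>P e. g p) q) =
    (\<Sum>ps | list_all2 (\<lambda>p e. p \<in> P e) ps q. \<phi> (us @ map g ps))"
proof (induction q arbitrary: us)
  case Nil
  have "{ps. list_all2 (\<lambda>p e. p \<in> P e) ps []} = {[]}" by auto
  then show ?case by simp
next
  case (Cons e q)
  let ?S = "{ps. list_all2 (\<lambda>p e. p \<in> P e) ps q}"
  have "\<phi> (us @ map (\<lambda>e. \<Sum>p\<in>P e. g p) (e # q)) =
      (\<Sum>p\<in>P e. \<phi> ((us @ [g p]) @ map (\<lambda>e. \<Sum>p\<in>P e. g p) q))"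
    by (simp add: multiadditive_sum[OF \<phi>])
  also have "\<dots> = (\<Sum>p\<in>P e. \<Sum>ps\<in>?S. \<phi> (us @ map g (p # ps)))"
    unfolding Cons.IH by simp
  also have "\<dots> = (\<Sum>(p, ps)\<in>P e \<times> ?S. \<phi> (us @ map g (p # ps)))"
    by (simp add: sum.cartesian_product)
  also have "\<dots> = (\<Sum>ps | list_all2 (\<lambda>p e. p \<in> P e) ps (e # q). \<phi> (us @ map g ps))"
    unfolding list_all2_Cons_image by (subst sum.reindex) (auto simp: inj_on_def case_prod_unfold)
  finally show ?case .
qed


section \<open>The bar involution\<close>

context graded_vector_space
begin

lemma homog_decomp_component: "homog_decomp V x (homog_component V x)"
  unfolding homog_component_def using direct_sum by (rule theI')

lemma homog_component_eqI: "homog_decomp V x c \<Longrightarrow> homog_component V x = c"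
  unfolding homog_component_def using direct_sum by (rule the1_equality)

lemma homogeneous_decomposition:
  obtains D c where "finite (D::'g set)" "\<And>d. c d \<in> V d" "x = (\<Sum>d\<in>D. c d)"
  using that[of "{d. homog_component V x d \<noteq> 0}" "homog_component V x"] homog_decomp_component[of x]
  by (simp add: homog_decomp_def Sum_any.expand_set)

lemma homog_component_add:
  "homog_component V (x + y) = (\<lambda>d. homog_component V x d + homog_component V y d)"
proof (rule homog_component_eqI)
  let ?c = "homog_component V"
  have x: "homog_decomp V x (?c x)" and y: "homog_decomp V y (?c y)"
    by (rule homog_decomp_component)+
  have "finite {d. ?c x d + ?c y d \<noteq> 0}"
    by (rule finite_subset[of _ "{d. ?c x d \<noteq> 0} \<union> {d. ?c y d \<noteq> 0}"])
      (use x y in \<open>auto simp: homog_decomp_def\<close>)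
  then show "homog_decomp V (x + y) (\<lambda>d. ?c x d + ?c y d)"
    using x y by (auto simp: homog_decomp_def Sum_any.distrib intro: subspace_add subspace_component)
qed

lemma finite_sign_act_component: "finite {d. sign_act d (homog_component V x d) \<noteq> 0}"
  by (rule finite_subset[of _ "{d. homog_component V x d \<noteq> 0}"])
    (use homog_decomp_component[of x] in \<open>auto simp: homog_decomp_def sign_act_def split: if_splits\<close>)

lemma bar_add: "bar V (x + y) = bar V x + bar V y"
  unfolding bar_def homog_component_add sign_act_plus
  by (rule Sum_any.distrib) (rule finite_sign_act_component)+

lemma bar_zero: "bar V 0 = 0"
  using bar_add[of 0 0] by simp

lemma bar_minus: "bar V (- x) = - bar V x"
  using bar_add[of "- x" x] by (simp add: bar_zero eq_neg_iff_add_eq_0)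

lemma bar_sum: "bar V (\<Sum>p\<in>P. g p) = (\<Sum>p\<in>P. bar V (g p))"
  by (induction P rule: infinite_finite_induct) (simp_all add: bar_zero bar_add)

lemma bar_homogeneous:
  assumes "x \<in> V d" shows "bar V x = sign_act d x"
proof -
  have *: "Sum_any (\<lambda>d'. if d' = d then y else 0) = y" for y :: 'a
    by (subst Sum_any.expand_superset[of "{d}"]) auto
  have "homog_component V x = (\<lambda>d'. if d' = d then x else 0)"
    by (rule homog_component_eqI)
      (use assms * in \<open>auto simp: homog_decomp_def intro: subspace_0 subspace_component
        finite_subset[of _ "{d}"]\<close>)
  then have "bar V x = Sum_any (\<lambda>d'. if d' = d then sign_act d x else 0)"
    unfolding bar_def by (intro arg_cong[where f = Sum_any] ext) (auto simp: sign_act_def)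
  then show ?thesis using * by simp
qed

lemma bar_bar: "bar V (bar V x) = x"
proof -
  obtain D c where D: "\<And>d. c d \<in> V d" and x: "x = (\<Sum>d\<in>D. c d)"
    using homogeneous_decomposition by metis
  have "bar V (bar V (c d)) = c d" for d
    using bar_homogeneous[OF D, of d] by (simp add: sign_act_def bar_minus)
  then show ?thesis unfolding x by (simp add: bar_sum)
qed

text \<open>
  Every letter is a finite sum of homogeneous elements. The induction replaces the letters of the
  word from left to right: \<open>us\<close> is the part that is already homogeneous.
\<close>

lemma multiadditive_eqI:
  assumes \<phi>: "multiadditive \<phi>" and \<psi>: "multiadditive \<psi>"
    and eq: "\<And>xs ds. xs \<noteq> [] \<Longrightarrow> homogeneous_list V xs ds \<Longrightarrow> \<phi> xs = \<psi> xs"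
    and "xs \<noteq> []"
  shows "\<phi> xs = \<psi> xs"
proof -
  have "\<phi> (us @ vs) = \<psi> (us @ vs)" if "us @ vs \<noteq> []" "homogeneous_list V us ds" for us vs ds
    using that
  proof (induction vs arbitrary: us ds)
    case Nil
    then have "us \<noteq> []" by simp
    from eq[OF this Nil.prems(2)] show ?case by simp
  next
    case (Cons z vs)
    obtain D c where D: "\<And>d. c d \<in> V d" and z: "z = (\<Sum>d\<in>D. c d)"
      using homogeneous_decomposition by metis
    have "\<phi> (us @ c d # vs) = \<psi> (us @ c d # vs)" for d
    proof -
      have "homogeneous_list V (us @ [c d]) (ds @ [d])"
        using Cons.prems(2) D[of d] by (auto simp: homogeneous_list_def intro: list_all2_appendI)
      from Cons.IH[OF _ this] show ?thesis by simp
    qed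
    then show ?case unfolding z by (simp only: multiadditive_sum[OF \<phi>] multiadditive_sum[OF \<psi>])
  qed
  from this[of "[]" xs "[]"] assms(4) show ?thesis by (simp add: homogeneous_list_def)
qed

lemma multiadditive_bar_homogeneous:
  assumes "multiadditive \<phi>" "homogeneous_list V xs ds"
  shows "\<phi> (us @ map (bar V) xs @ vs) = sign_act (sum_list ds) (\<phi> (us @ xs @ vs))"
  using assms(2)
proof (induction xs arbitrary: us ds)
  case Nil
  then show ?case by (simp add: homogeneous_list_def)
next
  case (Cons x xs)
  then obtain d ds' where ds: "ds = d # ds'" and d: "x \<in> V d" and h: "homogeneous_list V xs ds'"
    by (auto simp: homogeneous_list_def list_all2_Cons1)
  have "\<phi> (us @ map (bar V) (x # xs) @ vs) = sign_act d (\<phi> ((us @ [x]) @ map (bar V) xs @ vs))"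
    by (simp add: bar_homogeneous[OF d] multiadditive_sign_act[OF assms(1)])
  also have "\<dots> = sign_act d (sign_act (sum_list ds') (\<phi> ((us @ [x]) @ xs @ vs)))"
    unfolding Cons.IH[OF h] ..
  finally show ?case by (simp add: ds sign_act_add)
qed

end

text \<open>
  This gives both sign rules used later: maps of degree 0 commute with the bar, while \<open>b\<close>, being of
  degree 1, anticommutes with it.
\<close>

lemma bar_of_degree:
  assumes "graded_vector_space sA VA" "graded_vector_space sB VB"
    and \<phi>: "multiadditive \<phi>" and deg: "of_degree VA VB e \<phi>" and "xs \<noteq> []"
  shows "\<phi> (map (bar VA) xs) = sign_act e (bar VB (\<phi> xs))"
proof -
  interpret A: graded_vector_space sA VA by fact
  interpret B: graded_vector_space sB VB by fact
  show ?thesis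
  proof (rule A.multiadditive_eqI[where \<phi> = "\<lambda>xs. \<phi> (map (bar VA) xs)"
        and \<psi> = "\<lambda>xs. sign_act e (bar VB (\<phi> xs))"])
    show "multiadditive (\<lambda>xs. \<phi> (map (bar VA) xs))"
      using \<phi> A.bar_add by (rule multiadditive_map)
    show "multiadditive (\<lambda>xs. sign_act e (bar VB (\<phi> xs)))"
      using \<phi> by (simp add: multiadditive_def B.bar_add sign_act_plus)
    show "\<phi> (map (bar VA) xs) = sign_act e (bar VB (\<phi> xs))"
      if "xs \<noteq> []" "homogeneous_list VA xs ds" for xs ds
    proof -
      have "\<phi> xs \<in> VB (sum_list ds + e)" using deg that by (auto simp: of_degree_def)
      then have "bar VB (\<phi> xs) = sign_act e (sign_act (sum_list ds) (\<phi> xs))"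
        by (simp add: B.bar_homogeneous add.commute flip: sign_act_add)
      then show ?thesis
        using A.multiadditive_bar_homogeneous[OF \<phi> that(2), of "[]" "[]"]
        by (simp add: sign_act_involution)
    qed
  qed fact
qed


section \<open>The structure relations on arbitrary words\<close>

text \<open>
  The sum of the structure relations with the Koszul sign \<open>(-1)^(d\<^sub>1 + \<dots> + d\<^sub>r)\<close> replaced by an application
  of \<open>h\<close> to the first \<open>r\<close> letters. For \<open>h\<close> the bar the two agree on homogeneous words, but the present form
  needs no degrees.
\<close>

definition bar_insertion_sum ::
  "('a::ab_group_add \<Rightarrow> 'a) \<Rightarrow> ('a list \<Rightarrow> 'b::ab_group_add) \<Rightarrow> ('a list \<Rightarrow> 'a) \<Rightarrow> 'a list \<Rightarrow> 'b" where
  "bar_insertion_sum h \<phi> b xs =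
     (\<Sum>(r, s, t) \<in> {(r, s, t). r + s + t = length xs \<and> 1 \<le> s}.
        \<phi> (map h (take r xs) @ [b (take s (drop r xs))] @ drop (r + s) xs))"

text \<open>
  The letter that varies lies before, inside or after the segment fed to \<open>b\<close>; these are the three
  cases of the proof.
\<close>

lemma multiadditive_insertion_term:
  assumes \<phi>: "multiadditive \<phi>" and b: "multiadditive b" and h: "\<And>x y. h (x + y) = h x + h y"
  shows "multiadditive (\<lambda>xs. \<phi> (map h (take r xs) @ [b (take s (drop r xs))] @ drop (r + s) xs))"
  unfolding multiadditive_def
proof (intro allI)
  fix us vs :: "'a list" and x y :: 'a
  note add = multiadditive_add[OF \<phi>]
  consider k where "r = length us + Suc k"
    | k where "r \<le> length us" "s = length us - r + Suc k" | "r + s \<le> length us"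
  proof -
    have "r = length us + Suc (r - Suc (length us))" if "length us < r" using that by simp
    moreover have "s = length us - r + Suc (r + s - Suc (length us))"
      if "r \<le> length us" "length us < r + s" using that by simp
    ultimately show thesis using that by (meson not_less)
  qed
  then show "\<phi> (map h (take r (us @ (x + y) # vs)) @ [b (take s (drop r (us @ (x + y) # vs)))] @
      drop (r + s) (us @ (x + y) # vs)) =
    \<phi> (map h (take r (us @ x # vs)) @ [b (take s (drop r (us @ x # vs)))] @
      drop (r + s) (us @ x # vs)) +
    \<phi> (map h (take r (us @ y # vs)) @ [b (take s (drop r (us @ y # vs)))] @
      drop (r + s) (us @ y # vs))"
  proof cases
    case 1
    then show ?thesis by (simp add: h add)
  next
    case 2
    then have "r + s - length us = Suc k" by simp
    with 2 show ?thesis by (simp add: multiadditive_add[OF b] add)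
  next
    case 3
    then show ?thesis
      using add[of "map h (take r us) @ b (take s (drop r us)) # drop (r + s) us" x y vs] by simp
  qed
qed

text \<open>
  The index sets of the structure relations depend on the word through its length alone, which
  does not change when a letter is replaced.
\<close>

lemma multiadditive_sum_family:
  assumes "\<And>us vs x y p. p \<in> P (length us + Suc (length vs)) \<Longrightarrow>
    T p (us @ (x + y) # vs) = T p (us @ x # vs) + T p (us @ y # vs)"
  shows "multiadditive (\<lambda>xs. \<Sum>p\<in>P (length xs). T p xs)"
  by (simp add: multiadditive_def assms flip: sum.distrib)

lemma multiadditive_bar_insertion_sum:
  assumes "multiadditive \<phi>" "multiadditive b" "\<And>x y. h (x + y) = h x + h y"
  shows "multiadditive (bar_insertion_sum h \<phi> b)"
  unfolding bar_insertion_sum_def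
proof (rule multiadditive_sum_family)
  fix us vs :: "'a list" and x y and p :: "nat \<times> nat \<times> nat"
  obtain r s t where p: "p = (r, s, t)" by (cases p)
  let ?T = "\<lambda>xs. \<phi> (map h (take r xs) @ [b (take s (drop r xs))] @ drop (r + s) xs)"
  have "?T (us @ (x + y) # vs) = ?T (us @ x # vs) + ?T (us @ y # vs)"
    by (rule multiadditive_add[OF multiadditive_insertion_term[OF assms]])
  then show "(case p of (r, s, t) \<Rightarrow> \<phi> (map h (take r (us @ (x + y) # vs)) @
        [b (take s (drop r (us @ (x + y) # vs)))] @ drop (r + s) (us @ (x + y) # vs))) =
      (case p of (r, s, t) \<Rightarrow> \<phi> (map h (take r (us @ x # vs)) @
        [b (take s (drop r (us @ x # vs)))] @ drop (r + s) (us @ x # vs))) +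
      (case p of (r, s, t) \<Rightarrow> \<phi> (map h (take r (us @ y # vs)) @
        [b (take s (drop r (us @ y # vs)))] @ drop (r + s) (us @ y # vs)))"
    unfolding p prod.case .
qed

lemma (in graded_vector_space) insertion_sum_eq_bar_insertion_sum:
  assumes "multiadditive \<phi>" "homogeneous_list V xs ds"
  shows "insertion_sum \<phi> b xs ds = bar_insertion_sum (bar V) \<phi> b xs"
proof -
  have "sign_act (sum_list (take r ds)) (\<phi> (take r xs @ vs)) = \<phi> (map (bar V) (take r xs) @ vs)"
    for r vs
  proof -
    have "homogeneous_list V (take r xs) (take r ds)"
      using assms(2) by (simp add: homogeneous_list_def list_all2_takeI)
    from multiadditive_bar_homogeneous[OF assms(1) this, of "[]" vs] show ?thesis by simp
  qed
  then show ?thesis unfolding insertion_sum_def bar_insertion_sum_def by simp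
qed

text \<open>
  The hypothesis on \<open>ns\<close> ensures that the varying letter is in one of the blocks instead of
  in a remainder that \<^const>\<open>blocks\<close> would drop.
\<close>

lemma multiadditive_blocks:
  assumes "multiadditive \<phi>" "multiadditive f" "sum_list ns = length us + Suc (length vs)"
  shows "\<phi> (map f (blocks ns (us @ (x + y) # vs))) =
    \<phi> (map f (blocks ns (us @ x # vs))) + \<phi> (map f (blocks ns (us @ y # vs)))"
  using assms(1,3)
proof (induction ns arbitrary: us \<phi>)
  case Nil
  then show ?case by simp
next
  case (Cons n ns)
  show ?case
  proof (cases "length us < n")
    case True
    then obtain k where k: "n = length us + Suc k" by (metis add_Suc_right less_iff_Suc_add)
    show ?thesis
      using multiadditive_add[OF Cons.prems(1), of "[]"]
      by (simp add: k multiadditive_add[OF assms(2)])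
  next
    case False
    then show ?thesis
      using Cons.IH[OF multiadditive_Cons[OF Cons.prems(1)], of "drop n us"] Cons.prems(2)
      by simp
  qed
qed

definition compositions :: "nat \<Rightarrow> nat list set" where
  "compositions n = {ns. (\<forall>k \<in> set ns. 0 < k) \<and> sum_list ns = n}"

text \<open>
  Both sides are additive in each letter and agree on homogeneous words by the relations of the
  morphism, so they agree on all words.
\<close>

lemma (in A_infinity_morphism) f_relation_bar:
  assumes "xs \<noteq> []"
  shows "bar_insertion_sum (bar VA) f bA xs =
    (\<Sum>ns\<in>compositions (length xs). bB (map f (blocks ns xs)))"
proof (rule A.multiadditive_eqI[where \<phi> = "bar_insertion_sum (bar VA) f bA"
      and \<psi> = "\<lambda>xs. \<Sum>ns\<in>compositions (length xs). bB (map f (blocks ns xs))"])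
  have f: "multiadditive f" and bA: "multiadditive bA" and bB: "multiadditive bB"
    using f_multilinear A.b_multilinear B.b_multilinear by (auto dest: multilinear_imp_multiadditive)
  show "multiadditive (bar_insertion_sum (bar VA) f bA)"
    using f bA A.bar_add by (rule multiadditive_bar_insertion_sum)
  show "multiadditive (\<lambda>xs. \<Sum>ns\<in>compositions (length xs). bB (map f (blocks ns xs)))"
    by (rule multiadditive_sum_family) (simp add: compositions_def multiadditive_blocks[OF bB f])
  show "bar_insertion_sum (bar VA) f bA xs =
      (\<Sum>ns\<in>compositions (length xs). bB (map f (blocks ns xs)))"
    if "xs \<noteq> []" "homogeneous_list VA xs ds" for xs ds
    using f_relation[OF that] A.insertion_sum_eq_bar_insertion_sum[OF f that(2)]
    by (simp add: compositions_def)
qed fact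


lemma finite_list_all2:
  assumes "\<And>d. finite (P d)"
  shows "finite {ps. list_all2 (\<lambda>p d. p \<in> P d) ps q}"
proof (induction q)
  case Nil
  have "{ps. list_all2 (\<lambda>p d. p \<in> P d) ps []} = {[]}" by auto
  then show ?case by simp
next
  case (Cons d q)
  then show ?case unfolding list_all2_Cons_image using assms by simp
qed

section \<open>Compositions and blocks\<close>

lemma finite_compositions: "finite (compositions n)"
proof (rule finite_subset)
  show "compositions n \<subseteq> {ns. set ns \<subseteq> {..n} \<and> length ns \<le> n}"
  proof
    fix ns assume ns: "ns \<in> compositions n"
    have "(\<forall>k\<in>set ns. 0 < k) \<Longrightarrow> length ns \<le> sum_list ns"
      by (induction ns) auto
    then show "ns \<in> {ns. set ns \<subseteq> {..n} \<and> length ns \<le> n}"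
      using ns member_le_sum_list[of _ ns] by (auto simp: compositions_def)
  qed
  show "finite {ns. set ns \<subseteq> {..n} \<and> length ns \<le> n}"
    by (rule finite_lists_length_le) simp
qed

lemma concat_blocks: "sum_list ns = length xs \<Longrightarrow> concat (blocks ns xs) = xs"
  by (induction ns arbitrary: xs) auto

lemma map_length_blocks: "sum_list ns = length xs \<Longrightarrow> map length (blocks ns xs) = ns"
proof (induction ns arbitrary: xs)
  case (Cons n ns)
  from Cons.prems Cons.IH[of "drop n xs"] show ?case by simp
qed simp

lemma blocks_concat: "blocks (map length ps) (concat ps) = ps"
  by (induction ps) auto

lemma blocks_map: "blocks ns (map g xs) = map (map g) (blocks ns xs)"
  by (induction ns arbitrary: xs) (auto simp: take_map drop_map)

section \<open>Path sums\<close>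

text \<open>
  A path is the list of its edges, so that composing paths is appending lists and the word of a
  path under a labelling \<open>E\<close> of the edges is \<open>map E p\<close>. Only nonempty paths enter
  the sums, just as \<open>\<phi>\<^sub>n\<close> is considered for \<open>n \<ge> 1\<close> only.
\<close>

fun path :: "('v \<times> 'v) set \<Rightarrow> 'v \<Rightarrow> ('v \<times> 'v) list \<Rightarrow> 'v \<Rightarrow> bool" where
  "path R i [] j \<longleftrightarrow> i = j"
| "path R i (d # p) j \<longleftrightarrow> d \<in> R \<and> fst d = i \<and> path R (snd d) p j"

definition paths :: "('v \<times> 'v) set \<Rightarrow> 'v \<times> 'v \<Rightarrow> ('v \<times> 'v) list set" where
  "paths R e = {p. p \<noteq> [] \<and> path R (fst e) p (snd e)}"

text \<open>The paths with a marked edge \<open>d\<close>, cut into \<open>p\<close>, \<open>d\<close> and \<open>q\<close>.\<close>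

definition splits ::
  "('v \<times> 'v) set \<Rightarrow> 'v \<times> 'v \<Rightarrow> (('v \<times> 'v) list \<times> ('v \<times> 'v) \<times> ('v \<times> 'v) list) set" where
  "splits R e = {(p, d, q). path R (fst e) (p @ d # q) (snd e)}"

definition path_sum ::
  "('v \<times> 'v) set \<Rightarrow> ('a list \<Rightarrow> 'b::comm_monoid_add) \<Rightarrow> ('v \<times> 'v \<Rightarrow> 'a) \<Rightarrow> 'v \<times> 'v \<Rightarrow> 'b" where
  "path_sum R \<phi> E e = (\<Sum>p\<in>paths R e. \<phi> (map E p))"

text \<open>
  For matrices this is the entry of \<open>\<Sum>\<^sub>r\<^sub>,\<^sub>t \<phi>(E, \<dots>, E, D, E', \<dots>, E')\<close> with \<open>r\<close> factors \<open>E\<close> and \<open>t\<close> factors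
  \<open>E'\<close>.
\<close>

definition split_sum ::
  "('v \<times> 'v) set \<Rightarrow> ('a list \<Rightarrow> 'b::comm_monoid_add) \<Rightarrow> ('v \<times> 'v \<Rightarrow> 'a) \<Rightarrow> ('v \<times> 'v \<Rightarrow> 'a) \<Rightarrow>
    ('v \<times> 'v \<Rightarrow> 'a) \<Rightarrow> 'v \<times> 'v \<Rightarrow> 'b" where
  "split_sum R \<phi> E D E' e = (\<Sum>(p, d, q)\<in>splits R e. \<phi> (map E p @ D d # map E' q))"

lemma path_append: "path R i (p @ q) j \<longleftrightarrow> (\<exists>k. path R i p k \<and> path R k q j)"
  by (induction p arbitrary: i) auto

lemma path_imp_subset: "path R i p j \<Longrightarrow> set p \<subseteq> R"
  by (induction p arbitrary: i) auto

lemma path_ends: "path R i p j \<Longrightarrow> p \<noteq> [] \<Longrightarrow> fst (hd p) = i \<and> snd (last p) = j"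
  by (induction p arbitrary: i) auto

lemma path_transitive:
  assumes "trans R" shows "path R i p j \<Longrightarrow> p \<noteq> [] \<Longrightarrow> (i, j) \<in> R"
proof (induction p arbitrary: i)
  case (Cons d p)
  then have d: "(i, snd d) \<in> R" by auto
  show ?case
  proof (cases "p = []")
    case True
    with Cons.prems d show ?thesis by simp
  next
    case False
    with Cons have "(snd d, j) \<in> R" by simp
    with d show ?thesis using assms by (meson transD)
  qed
qed simp

lemma mem_paths_ends: "p \<in> paths R d \<Longrightarrow> (fst (hd p), snd (last p)) = d"
  using path_ends by (fastforce simp: paths_def)

text \<open>
  The rank makes the relation acyclic and all path sums finite. By transitivity the end points of
  a nonempty path are themselves joined by an edge; this is what allows a segment of a path to be
  replaced by a single edge.
\<close>

locale graded_relation =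
  fixes R :: "('v \<times> 'v) set" and rank :: "'v \<Rightarrow> nat"
  assumes finite_R: "finite R" and trans_R: "trans R"
    and rank_less: "(i, j) \<in> R \<Longrightarrow> rank i < rank j"
begin

lemma length_path_le: "path R i p j \<Longrightarrow> length p + rank i \<le> rank j"
proof (induction p arbitrary: i)
  case (Cons d p)
  then have "length p + rank (snd d) \<le> rank j" "rank i < rank (snd d)"
    using rank_less[of "fst d" "snd d"] by auto
  then show ?case by simp
qed simp

lemma finite_path: "finite {p. path R i p j}"
proof (rule finite_subset)
  show "{p. path R i p j} \<subseteq> {p. set p \<subseteq> R \<and> length p \<le> rank j}"
    using path_imp_subset[of R i _ j] length_path_le[of i _ j] by fastforce
  show "finite {p. set p \<subseteq> R \<and> length p \<le> rank j}"
    by (rule finite_lists_length_le) (rule finite_R)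
qed

lemma finite_paths: "finite (paths R e)"
  using finite_path by (rule rev_finite_subset) (auto simp: paths_def)

lemma sum_splits:
  "(\<Sum>(p, d, q)\<in>splits R e. h p d q) =
    (\<Sum>p\<in>paths R e. \<Sum>r<length p. h (take r p) (p ! r) (drop (Suc r) p))"
proof -
  have "(\<Sum>p\<in>paths R e. \<Sum>r<length p. h (take r p) (p ! r) (drop (Suc r) p)) =
      (\<Sum>(p, r)\<in>Sigma (paths R e) (\<lambda>p. {..<length p}). h (take r p) (p ! r) (drop (Suc r) p))"
    by (rule sum.Sigma) (simp_all add: finite_paths)
  also have "\<dots> = (\<Sum>(p, d, q)\<in>splits R e. h p d q)"
    by (rule sum.reindex_bij_witness[where i = "\<lambda>(p, d, q). (p @ d # q, length p)"
          and j = "\<lambda>(p, r). (take r p, p ! r, drop (Suc r) p)"])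
      (auto simp: paths_def splits_def id_take_nth_drop[symmetric])
  finally show ?thesis ..
qed

lemma finite_splits: "finite (splits R e)"
proof (rule finite_subset)
  show "splits R e \<subseteq> (\<lambda>(p, r). (take r p, p ! r, drop (Suc r) p)) `
      Sigma (paths R e) (\<lambda>p. {..<length p})"
  proof
    fix x assume "x \<in> splits R e"
    then obtain p d q where x: "x = (p, d, q)" and "path R (fst e) (p @ d # q) (snd e)"
      by (auto simp: splits_def)
    then have "(p @ d # q, length p) \<in> Sigma (paths R e) (\<lambda>p. {..<length p})"
      by (simp add: paths_def)
    then show "x \<in> (\<lambda>(p, r). (take r p, p ! r, drop (Suc r) p)) `
        Sigma (paths R e) (\<lambda>p. {..<length p})"
      by (rule rev_image_eqI) (simp add: x)
  qed
qed (simp add: finite_paths)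

lemma splits_mem:
  assumes "(p, d, q) \<in> splits R e" shows "d \<in> R"
  using assms path_imp_subset[of R "fst e" "p @ d # q" "snd e"] by (simp add: splits_def)

text \<open>
  Passing between a coarse path and a list \<open>ps\<close> of nonempty fine paths, one for each of its edges.
  The coarse path can be recovered from \<open>ps\<close>, since a nonempty path determines its end points.
\<close>

lemma refine_path:
  "list_all2 (\<lambda>p d. p \<in> paths R d) ps q \<Longrightarrow> path R i q j \<Longrightarrow>
    path R i (concat ps) j \<and> [] \<notin> set ps \<and> map (\<lambda>p. (fst (hd p), snd (last p))) ps = q"
proof (induction ps q arbitrary: i rule: list_all2_induct)
  case Nil
  then show ?case by simp
next
  case (Cons p ps d q)
  then show ?case using mem_paths_ends[OF Cons.hyps(1)]
    by (auto simp: path_append paths_def)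
qed

lemma coarsen_path:
  "[] \<notin> set ps \<Longrightarrow> path R i (concat ps) j \<Longrightarrow>
    path R i (map (\<lambda>p. (fst (hd p), snd (last p))) ps) j \<and>
    list_all2 (\<lambda>p d. p \<in> paths R d) ps (map (\<lambda>p. (fst (hd p), snd (last p))) ps)"
proof (induction ps arbitrary: i)
  case Nil
  then show ?case by simp
next
  case (Cons p ps)
  then obtain k where p: "p \<noteq> []" "path R i p k" and ps: "path R k (concat ps) j"
    by (auto simp: path_append)
  with Cons.IH[OF _ ps] Cons.prems(1) path_ends[OF p(2,1)] path_transitive[OF trans_R p(2,1)]
  show ?case by (simp add: paths_def)
qed

text \<open>
  A coarse path with a refinement of each edge amounts to a list of nonempty composable paths, and
  such a list amounts to its concatenation together with the composition formed by the lengths.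
\<close>

lemma sum_refinements:
  "(\<Sum>q\<in>paths R e. \<Sum>ps | list_all2 (\<lambda>p d. p \<in> paths R d) ps q. G ps) =
    (\<Sum>p\<in>paths R e. \<Sum>ns\<in>compositions (length p). G (blocks ns p))"
proof -
  let ?P = "\<lambda>q. {ps. list_all2 (\<lambda>p d. p \<in> paths R d) ps q}"
  let ?ends = "\<lambda>p. (fst (hd p), snd (last p))"
  let ?S = "{ps. ps \<noteq> [] \<and> [] \<notin> set ps \<and> path R (fst e) (concat ps) (snd e)}"
  have "(\<Sum>q\<in>paths R e. \<Sum>ps\<in>?P q. G ps) = (\<Sum>(q, ps)\<in>Sigma (paths R e) ?P. G ps)"
    by (rule sum.Sigma) (simp_all add: finite_paths finite_list_all2)
  also have "\<dots> = (\<Sum>ps\<in>?S. G ps)"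
  proof (rule sum.reindex_bij_witness[where i = "\<lambda>ps. (map ?ends ps, ps)" and j = snd])
    fix x assume "x \<in> Sigma (paths R e) ?P"
    then obtain q ps where x: "x = (q, ps)" and q: "q \<noteq> []" "path R (fst e) q (snd e)"
      and ps: "list_all2 (\<lambda>p d. p \<in> paths R d) ps q"
      by (auto simp: paths_def)
    from refine_path[OF ps q(2)] q(1) show "(map ?ends (snd x), snd x) = x" "snd x \<in> ?S"
      by (auto simp: x)
    show "G (snd x) = (case x of (q, ps) \<Rightarrow> G ps)" by (simp add: x)
  next
    fix ps assume "ps \<in> ?S"
    with coarsen_path[of ps "fst e" "snd e"]
    show "(map ?ends ps, ps) \<in> Sigma (paths R e) ?P" by (simp add: paths_def)
  qed simp
  also have "\<dots> = (\<Sum>(p, ns)\<in>Sigma (paths R e) (\<lambda>p. compositions (length p)). G (blocks ns p))"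
  proof (rule sum.reindex_bij_witness[where i = "\<lambda>(p, ns). blocks ns p"
        and j = "\<lambda>ps. (concat ps, map length ps)"])
    fix ps assume "ps \<in> ?S"
    then show "(concat ps, map length ps) \<in> Sigma (paths R e) (\<lambda>p. compositions (length p))"
      by (cases ps) (auto simp: paths_def compositions_def length_concat)
  next
    fix x assume "x \<in> Sigma (paths R e) (\<lambda>p. compositions (length p))"
    then obtain p ns where x: "x = (p, ns)" and p: "p \<noteq> []" "path R (fst e) p (snd e)"
      and ns: "\<forall>k\<in>set ns. 0 < k" "sum_list ns = length p"
      by (auto simp: paths_def compositions_def)
    note l = concat_blocks[OF ns(2)] map_length_blocks[OF ns(2)]
    from l show "(concat (case x of (p, ns) \<Rightarrow> blocks ns p),
        map length (case x of (p, ns) \<Rightarrow> blocks ns p)) = x" by (simp add: x)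
    have "[] \<notin> set (blocks ns p)"
    proof
      assume "[] \<in> set (blocks ns p)"
      then have "0 \<in> set (map length (blocks ns p))" by force
      then show False using l(2) ns(1) by auto
    qed
    moreover have "blocks ns p \<noteq> []" using l(1) p(1) by auto
    ultimately show "(case x of (p, ns) \<Rightarrow> blocks ns p) \<in> ?S" using p(2) l(1) by (simp add: x)
  qed (simp_all add: blocks_concat)
  also have "\<dots> = (\<Sum>p\<in>paths R e. \<Sum>ns\<in>compositions (length p). G (blocks ns p))"
    by (rule sum.Sigma[symmetric]) (simp_all add: finite_paths finite_compositions)
  finally show ?thesis .
qed

lemma path_sum_comp:
  assumes "multiadditive \<phi>"
  shows "path_sum R \<phi> (path_sum R f E) e =
    (\<Sum>p\<in>paths R e. \<Sum>ns\<in>compositions (length p). \<phi> (map f (blocks ns (map E p))))"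
proof -
  have "path_sum R \<phi> (path_sum R f E) e =
      (\<Sum>q\<in>paths R e. \<phi> ([] @ map (\<lambda>d. \<Sum>p\<in>paths R d. f (map E p)) q))"
    by (simp add: path_sum_def[abs_def])
  also have "\<dots> = (\<Sum>q\<in>paths R e. \<Sum>ps | list_all2 (\<lambda>p d. p \<in> paths R d) ps q.
      \<phi> (map (\<lambda>p. f (map E p)) ps))"
    by (subst multiadditive_expand_sums[OF assms]) simp
  also have "\<dots> = (\<Sum>p\<in>paths R e. \<Sum>ns\<in>compositions (length p).
      \<phi> (map (\<lambda>p. f (map E p)) (blocks ns p)))"
    by (rule sum_refinements)
  finally show ?thesis by (simp add: blocks_map o_def)
qed

text \<open>
  Choosing a marked edge and a path refining it is the same as choosing a path and a nonempty
  segment of it. In this way the edge label \<^term>\<open>path_sum R b E d\<close> collects the values of \<open>b\<close> on all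
  segments with the same end points.
\<close>

lemma split_sum_path_sum:
  assumes "multiadditive \<phi>"
  shows "split_sum R \<phi> (h \<circ> E) (path_sum R b E) E e =
    (\<Sum>p\<in>paths R e. bar_insertion_sum h \<phi> b (map E p))"
proof -
  let ?I = "\<lambda>p. {(r, s, t). r + s + t = length p \<and> (1::nat) \<le> s}"
  let ?T = "\<lambda>p q p'. \<phi> (map (h \<circ> E) p @ b (map E q) # map E p')"
  \<comment> \<open>\<open>cut\<close> contracts the segment of length \<open>s\<close> starting at position \<open>r\<close> to an edge and keeps the segment;
    \<open>glue\<close> is its inverse.\<close>
  define cut where "cut = (\<lambda>(p :: ('v \<times> 'v) list, r, s, t :: nat). let q = take s (drop r p) in
    ((take r p, (fst (hd q), snd (last q)), drop (r + s) p), q))"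
  define glue where "glue = (\<lambda>((p, d :: 'v \<times> 'v, p'), q :: ('v \<times> 'v) list).
    (p @ q @ p', length p, length q, length p'))"
  have fin: "finite (?I p)" for p :: "('v \<times> 'v) list"
    by (rule finite_subset[of _ "{..length p} \<times> {..length p} \<times> {..length p}"]) auto
  have "(\<Sum>p\<in>paths R e. bar_insertion_sum h \<phi> b (map E p)) =
      (\<Sum>p\<in>paths R e. \<Sum>(r, s, t)\<in>?I p. ?T (take r p) (take s (drop r p)) (drop (r + s) p))"
    by (simp add: bar_insertion_sum_def take_map drop_map)
  also have "\<dots> = (\<Sum>(p, r, s, t)\<in>Sigma (paths R e) ?I.
      ?T (take r p) (take s (drop r p)) (drop (r + s) p))"
    by (rule sum.Sigma) (use finite_paths fin in auto)
  also have "\<dots> = (\<Sum>((p, d, p'), q)\<in>Sigma (splits R e) (\<lambda>(p, d, p'). paths R d). ?T p q p')"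
  proof (rule sum.reindex_bij_witness[where j = cut and i = glue])
    fix x assume "x \<in> Sigma (paths R e) ?I"
    then obtain p r s t where x: "x = (p, r, s, t)" and path: "path R (fst e) p (snd e)"
      and len: "r + s + t = length p" "1 \<le> s"
      by (auto simp: paths_def)
    define p1 p2 p3 where "p1 = take r p" and "p2 = take s (drop r p)" and "p3 = drop (r + s) p"
    note defs = p1_def p2_def p3_def
    have p: "p1 @ p2 @ p3 = p"
      unfolding defs by (metis append_take_drop_id drop_drop add.commute)
    have l: "length p1 = r" "length p2 = s" "length p3 = t" using len by (auto simp: defs)
    have ne: "p2 \<noteq> []" using l len by auto
    obtain k l where "path R (fst e) p1 k" and kl: "path R k p2 l" and "path R l p3 (snd e)"
      using path unfolding p[symmetric] path_append by blast
    moreover have "(k, l) \<in> R" using path_transitive[OF trans_R kl ne] .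
    ultimately have split: "(p1, (k, l), p3) \<in> splits R e"
      by (auto simp: splits_def path_append)
    have cut: "cut x = ((p1, (k, l), p3), p2)"
      using path_ends[OF kl ne] by (simp add: x cut_def Let_def flip: defs)
    then show "cut x \<in> Sigma (splits R e) (\<lambda>(p, d, p'). paths R d)"
      using split kl ne by (simp add: paths_def)
    show "glue (cut x) = x" unfolding cut using p l by (simp add: glue_def x)
    show "(\<lambda>((p, d, p'), q). ?T p q p') (cut x) =
        (case x of (p, r, s, t) \<Rightarrow> ?T (take r p) (take s (drop r p)) (drop (r + s) p))"
      by (simp add: x cut_def Let_def)
  next
    fix y assume "y \<in> Sigma (splits R e) (\<lambda>(p, d, p'). paths R d)"
    then obtain p d p' q where y: "y = ((p, d, p'), q)"
      and path: "path R (fst e) (p @ d # p') (snd e)" and q: "q \<noteq> []" "path R (fst d) q (snd d)"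
      by (auto simp: splits_def paths_def)
    have "path R (fst e) (p @ q @ p') (snd e)"
      using path q(2) by (auto simp: path_append)
    then show "glue y \<in> Sigma (paths R e) ?I"
      using q(1) by (auto simp: y glue_def paths_def Suc_le_eq)
    show "cut (glue y) = y"
      using path_ends[OF q(2,1)] by (simp add: y cut_def Let_def glue_def prod_eq_iff)
  qed
  also have "\<dots> = (\<Sum>x\<in>splits R e. \<Sum>q\<in>(\<lambda>(p, d, p'). paths R d) x.
      (\<lambda>(p, d, p') q. ?T p q p') x q)"
    by (subst sum.Sigma) (auto simp: finite_splits finite_paths intro!: sum.cong)
  also have "\<dots> = (\<Sum>(p, d, p')\<in>splits R e. \<phi> (map (h \<circ> E) p @ path_sum R b E d # map E p'))"
    by (rule sum.cong) (auto simp: path_sum_def multiadditive_sum[OF assms])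
  finally show ?thesis by (simp add: split_sum_def)
qed

text \<open>
  By additivity, the term of a marked edge is a difference of the values of \<open>\<phi>\<close> at two words on
  the same path, whose labels switch from \<open>E'\<close> to \<open>E\<close> right after the marked edge and right before it.
\<close>

lemma split_sum_telescope:
  assumes "multiadditive \<phi>"
  shows "split_sum R \<phi> E' (\<lambda>d. E' d - E d) E e = path_sum R \<phi> E' e - path_sum R \<phi> E e"
proof -
  have "(\<Sum>r<length p. \<phi> (map E' (take r p) @ (E' (p ! r) - E (p ! r)) # map E (drop (Suc r) p))) =
      \<phi> (map E' p) - \<phi> (map E p)" for p
  proof -
    let ?g = "\<lambda>r. \<phi> (map E' (take r p) @ map E (drop r p))"
    have "(\<Sum>r<length p. \<phi> (map E' (take r p) @ (E' (p ! r) - E (p ! r)) # map E (drop (Suc r) p))) =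
        (\<Sum>r<length p. ?g (Suc r) - ?g r)"
      by (rule sum.cong)
        (simp_all add: multiadditive_diff[OF assms] take_Suc_conv_app_nth flip: Cons_nth_drop_Suc)
    also have "\<dots> = ?g (length p) - ?g 0" by (rule sum_lessThan_telescope)
    finally show ?thesis by simp
  qed
  then show ?thesis unfolding split_sum_def sum_splits path_sum_def by (simp add: sum_subtractf)
qed

end

text \<open>
  The central identity. The left-hand side, expanded over refinements, is the sum over all fine
  paths of the right-hand side of the morphism relations; the right-hand side, expanded over
  segments, is the sum of their left-hand side.
\<close>

lemma (in A_infinity_morphism) path_sum_morphism:
  assumes "graded_relation R rank"
  shows "path_sum R bB (path_sum R f E) e =
    split_sum R f (bar VA \<circ> E) (path_sum R bA E) E e"
proof -
  interpret graded_relation R rank by fact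
  have f: "multiadditive f" and bB: "multiadditive bB"
    using f_multilinear B.b_multilinear by (auto dest: multilinear_imp_multiadditive)
  have "path_sum R bB (path_sum R f E) e =
      (\<Sum>p\<in>paths R e. bar_insertion_sum (bar VA) f bA (map E p))"
    unfolding path_sum_comp[OF bB]
    by (rule sum.cong) (simp_all add: f_relation_bar paths_def)
  then show ?thesis by (simp add: split_sum_path_sum[OF f])
qed


section \<open>Matrices as labellings of edges\<close>

definition edges :: "nat \<Rightarrow> (nat \<times> nat) set" where
  "edges m = {(k, l). k < l \<and> l \<le> m}"

lemma graded_relation_edges: "graded_relation (edges m) id"
proof
  show "finite (edges m)"
    by (rule finite_subset[of _ "{..m} \<times> {..m}"]) (auto simp: edges_def)
  show "trans (edges m)" by (rule transI) (auto simp: edges_def)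
qed (auto simp: edges_def)

interpretation edges: graded_relation "edges m" id for m
  by (rule graded_relation_edges)

lemma Mat_plus_zero: "a \<in> Mat_plus m \<Longrightarrow> (i, j) \<notin> edges m \<Longrightarrow> a i j = 0"
  unfolding Mat_plus_def edges_def by blast

lemma paths_edges: "(i, j) \<notin> edges m \<Longrightarrow> paths (edges m) (i, j) = {}"
  using path_transitive[OF edges.trans_R] by (auto simp: paths_def)

lemma path_sum_mem_Mat_plus: "curry (path_sum (edges m) \<phi> E) \<in> Mat_plus m"
proof -
  have "path_sum (edges m) \<phi> E (i, j) = 0" if "\<not> (i < j \<and> j \<le> m)" for i j
  proof -
    have "(i, j) \<notin> edges m" using that by (simp add: edges_def)
    then show ?thesis by (simp add: path_sum_def paths_edges)
  qed
  then show ?thesis by (simp add: Mat_plus_def)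
qed

lemma split_sum_mem_Mat_plus: "curry (split_sum (edges m) \<phi> E D E') \<in> Mat_plus m"
proof -
  have "split_sum (edges m) \<phi> E D E' (i, j) = 0" if "\<not> (i < j \<and> j \<le> m)" for i j
  proof -
    have "(i, j) \<notin> edges m" using that by (simp add: edges_def)
    then show ?thesis by (simp add: split_sum_def edges.sum_splits paths_edges)
  qed
  then show ?thesis by (simp add: Mat_plus_def)
qed

lemma on_tensor_odots_Nil: "on_tensor \<phi> (odots m []) i j = (if i = j then \<phi> [] else 0)"
  by (simp add: on_tensor_def odots_def odot_one_def)

lemma on_tensor_odots_Cons:
  "on_tensor \<phi> (odots m (a # as)) i j = (\<Sum>k\<le>m. on_tensor (\<lambda>w. \<phi> (a i k # w)) (odots m as) k j)"
proof -
  have *: "(\<Sum>w\<in>#(\<Sum>k\<in>K. M k). \<phi> w) = (\<Sum>k\<in>K. \<Sum>w\<in>#M k. \<phi> w)"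
    for K :: "nat set" and M
    by (induction K rule: infinite_finite_induct) simp_all
  show ?thesis
    by (simp add: on_tensor_def odots_def odot_def pure_mat_def * image_mset.compositionality o_def)
qed

text \<open>
  Expanding the product of matrices factor by factor gives all sequences of indices; those that
  are not strictly increasing contribute a zero letter.
\<close>

lemma on_tensor_odots:
  assumes "multiadditive \<phi>" "set as \<subseteq> Mat_plus m"
  shows "on_tensor \<phi> (odots m as) i j =
    (\<Sum>p | path (edges m) i p j \<and> length p = length as. \<phi> (map2 case_prod as p))"
  using assms
proof (induction as arbitrary: \<phi> i)
  case Nil
  have "{p. path (edges m) i p j \<and> length p = 0} = (if i = j then {[]} else {})" by auto
  then show ?case by (simp add: on_tensor_odots_Nil)
next
  case (Cons a as)
  let ?P = "\<lambda>k. {p. path (edges m) k p j \<and> length p = length as}"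
  let ?K = "{k. (i, k) \<in> edges m}"
  have fin: "finite (?P k)" for k
    using edges.finite_path by (rule rev_finite_subset) auto
  have finK: "finite ?K" by (rule finite_subset[of _ "{..m}"]) (auto simp: edges_def)
  have "on_tensor \<phi> (odots m (a # as)) i j =
      (\<Sum>k\<le>m. \<Sum>p\<in>?P k. \<phi> (a i k # map2 case_prod as p))"
    unfolding on_tensor_odots_Cons
    using Cons.IH[OF multiadditive_Cons[OF Cons.prems(1)]] Cons.prems(2) by simp
  also have "\<dots> = (\<Sum>k\<in>?K. \<Sum>p\<in>?P k. \<phi> (a i k # map2 case_prod as p))"
  proof (rule sum.mono_neutral_right)
    show "\<forall>k\<in>{..m} - ?K. (\<Sum>p\<in>?P k. \<phi> (a i k # map2 case_prod as p)) = 0"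
    proof
      fix k assume "k \<in> {..m} - ?K"
      then have "a i k = 0" using Cons.prems(2) Mat_plus_zero by auto
      then show "(\<Sum>p\<in>?P k. \<phi> (a i k # map2 case_prod as p)) = 0"
        using multiadditive_zero[OF Cons.prems(1), of "[]"] by simp
    qed
  qed (auto simp: edges_def)
  also have "\<dots> = (\<Sum>(k, p)\<in>Sigma ?K ?P. \<phi> (a i k # map2 case_prod as p))"
    by (rule sum.Sigma) (use finK fin in auto)
  also have "\<dots> = (\<Sum>p | path (edges m) i p j \<and> length p = length (a # as).
      \<phi> (map2 case_prod (a # as) p))"
    by (rule sum.reindex_bij_witness[where j = "\<lambda>(k, p). (i, k) # p"
          and i = "\<lambda>p. (snd (hd p), tl p)"]) (auto simp: length_Suc_conv)
  finally show ?case .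
qed

lemma map2_replicate: "length p = n \<Longrightarrow> map2 g (replicate n a) p = map (g a) p"
  by (simp add: zip_replicate1 o_def)

lemma power_sum_eq_path_sum:
  assumes \<phi>: "multiadditive \<phi>" and a: "a \<in> Mat_plus m"
  shows "power_sum m \<phi> a = curry (path_sum (edges m) \<phi> (case_prod a))"
proof (intro ext)
  fix i j
  let ?g = "\<lambda>n. \<Sum>p | p \<in> paths (edges m) (i, j) \<and> length p - 1 = n. \<phi> (map (case_prod a) p)"
  have eq: "on_tensor \<phi> (odots m (replicate (Suc n) a)) i j = ?g n" for n
  proof -
    have "on_tensor \<phi> (odots m (replicate (Suc n) a)) i j =
        (\<Sum>p | path (edges m) i p j \<and> length p = length (replicate (Suc n) a).
          \<phi> (map2 case_prod (replicate (Suc n) a) p))"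
      by (rule on_tensor_odots[OF \<phi>]) (use a in auto)
    also have "\<dots> = ?g n"
    proof (rule sum.cong)
      show "{p. path (edges m) i p j \<and> length p = length (replicate (Suc n) a)} =
          {p. p \<in> paths (edges m) (i, j) \<and> length p - 1 = n}"
        by (auto simp: paths_def)
      fix p assume "p \<in> {p. p \<in> paths (edges m) (i, j) \<and> length p - 1 = n}"
      then have "length p = Suc n" by (auto simp: paths_def)
      then show "\<phi> (map2 case_prod (replicate (Suc n) a) p) = \<phi> (map (case_prod a) p)"
        by (simp only: map2_replicate)
    qed
    finally show ?thesis .
  qed
  \<comment> \<open>Every edge increases the index, so a path to \<open>j\<close> has at most \<open>j\<close> edges.\<close>
  have le: "length p - 1 < j" if "p \<in> paths (edges m) (i, j)" for p
    using that edges.length_path_le[of m i p j] by (cases p) (auto simp: paths_def)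
  have "Sum_any ?g = (\<Sum>n<j. ?g n)"
  proof (rule Sum_any.expand_superset)
    show "{n. ?g n \<noteq> 0} \<subseteq> {..<j}"
    proof
      fix n assume "n \<in> {n. ?g n \<noteq> 0}"
      then obtain p where "p \<in> paths (edges m) (i, j)" "length p - 1 = n"
        by (auto elim: sum.not_neutral_contains_not_neutral)
      then show "n \<in> {..<j}" using le by auto
    qed
  qed simp
  also have "\<dots> = (\<Sum>p\<in>paths (edges m) (i, j). \<phi> (map (case_prod a) p))"
    by (rule sum.group) (use le edges.finite_paths in auto)
  finally show "power_sum m \<phi> a i j = curry (path_sum (edges m) \<phi> (case_prod a)) i j"
    by (simp only: power_sum_def eq path_sum_def curry_def)
qed

text \<open>
  For given \<open>(r, t)\<close> the words are those of paths whose marked edge, labelled by \<open>c\<close>, has \<open>r\<close>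
  edges before it and \<open>t\<close> edges after it.
\<close>

lemma mixed_power_sum_eq_split_sum:
  assumes \<phi>: "multiadditive \<phi>" and mats: "a' \<in> Mat_plus m" "c \<in> Mat_plus m" "a \<in> Mat_plus m"
  shows "Sum_any (\<lambda>(r, t). on_tensor \<phi> (odots m (replicate r a' @ [c] @ replicate t a)) i j) =
    split_sum (edges m) \<phi> (case_prod a') (case_prod c) (case_prod a) (i, j)"
proof -
  let ?h = "\<lambda>(p, d, q). \<phi> (map (case_prod a') p @ case_prod c d # map (case_prod a) q)"
  let ?l = "\<lambda>(p, d, q). (length p, length q)"
  let ?S = "splits (edges m) (i, j)"
  let ?g = "\<lambda>n. \<Sum>x | x \<in> ?S \<and> ?l x = n. ?h x"
  have eq: "on_tensor \<phi> (odots m (replicate r a' @ [c] @ replicate t a)) i j = ?g (r, t)" for r t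
  proof -
    let ?as = "replicate r a' @ [c] @ replicate t a"
    have "on_tensor \<phi> (odots m ?as) i j =
        (\<Sum>p | path (edges m) i p j \<and> length p = length ?as. \<phi> (map2 case_prod ?as p))"
      by (rule on_tensor_odots[OF \<phi>]) (use mats in auto)
    also have "\<dots> = ?g (r, t)"
    proof (rule sum.reindex_bij_witness[where i = "\<lambda>(p, d, q). p @ d # q"
          and j = "\<lambda>p. (take r p, p ! r, drop (Suc r) p)"])
      fix p assume "p \<in> {p. path (edges m) i p j \<and> length p = length ?as}"
      then have p: "path (edges m) i p j" "length p = r + Suc t" by auto
      define p1 d p2 where "p1 = take r p" and "d = p ! r" and "p2 = drop (Suc r) p"
      note defs = p1_def d_def p2_def
      have p': "p = p1 @ d # p2" and l: "length p1 = r" "length p2 = t"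
        using p(2) by (auto simp: defs id_take_nth_drop)
      have cut: "(take r p, p ! r, drop (Suc r) p) = (p1, d, p2)" by (simp add: defs)
      show "(case (take r p, p ! r, drop (Suc r) p) of (p, d, q) \<Rightarrow> p @ d # q) = p"
        unfolding cut by (simp flip: p')
      show "(take r p, p ! r, drop (Suc r) p) \<in> {x. x \<in> ?S \<and> ?l x = (r, t)}"
        unfolding cut using p(1) l by (simp add: splits_def flip: p')
      have "map2 case_prod ?as p = map (case_prod a') p1 @ case_prod c d # map (case_prod a) p2"
        unfolding p' using l by (simp del: map_eq_conv add: map2_replicate)
      then show "?h (take r p, p ! r, drop (Suc r) p) = \<phi> (map2 case_prod ?as p)"
        unfolding cut by simp
    qed (auto simp: splits_def)
    finally show ?thesis .
  qed
  have le: "?l x \<in> {..<j} \<times> {..<j}" if "x \<in> ?S" for x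
    using that edges.length_path_le[of m i _ j] by (fastforce simp: splits_def)
  have "Sum_any ?g = (\<Sum>n\<in>{..<j} \<times> {..<j}. ?g n)"
  proof (rule Sum_any.expand_superset)
    show "{n. ?g n \<noteq> 0} \<subseteq> {..<j} \<times> {..<j}"
    proof
      fix n assume "n \<in> {n. ?g n \<noteq> 0}"
      then obtain x where "x \<in> ?S" "?l x = n"
        by (auto elim: sum.not_neutral_contains_not_neutral)
      then show "n \<in> {..<j} \<times> {..<j}" using le by blast
    qed
  qed simp
  also have "\<dots> = (\<Sum>x\<in>?S. ?h x)"
    by (rule sum.group) (use le edges.finite_splits in auto)
  moreover have "(\<lambda>(r, t). on_tensor \<phi> (odots m (replicate r a' @ [c] @ replicate t a)) i j) = ?g"
    by (rule ext) (simp only: eq split_beta prod.collapse)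
  ultimately show ?thesis by (simp only: split_sum_def)
qed


section \<open>Block matrices\<close>

text \<open>
  The index set of a block matrix with two blocks: \<open>(False, k)\<close> and \<open>(True, k)\<close> are the copies of \<open>k\<close> in the first and
  second block. As \<open>False \<le> True\<close>, edges lead from the first to the second block but not back. An
  edge between the blocks also has to increase the index, as \<open>c\<close> is strictly upper triangular.
\<close>

definition block_edges :: "nat \<Rightarrow> ((bool \<times> nat) \<times> (bool \<times> nat)) set" where
  "block_edges m = {d. fst (fst d) \<le> fst (snd d) \<and> (snd (fst d), snd (snd d)) \<in> edges m}"

definition lift :: "bool \<Rightarrow> bool \<Rightarrow> nat \<times> nat \<Rightarrow> (bool \<times> nat) \<times> (bool \<times> nat)" where
  "lift x y d = ((x, fst d), (y, snd d))"

definition block_matrix ::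
  "(nat \<times> nat \<Rightarrow> 'a) \<Rightarrow> (nat \<times> nat \<Rightarrow> 'a) \<Rightarrow> (nat \<times> nat \<Rightarrow> 'a) \<Rightarrow> (bool \<times> nat) \<times> (bool \<times> nat) \<Rightarrow> 'a" where
  "block_matrix E D E' = (\<lambda>((x, k), (y, l)).
     if x then E' (k, l) else if y then D (k, l) else E (k, l))"

lemma block_matrix_lift [simp]:
  "block_matrix E D E' \<circ> lift False False = E"
  "block_matrix E D E' \<circ> lift False True = D"
  "block_matrix E D E' \<circ> lift True True = E'"
  by (auto simp: block_matrix_def lift_def)

lemma fst_lift [simp]: "fst (lift x y d) = (x, fst d)"
  and snd_lift [simp]: "snd (lift x y d) = (y, snd d)"
  by (simp_all add: lift_def)

lemma lift_eq_iff: "lift x y d = lift x' y' d' \<longleftrightarrow> x = x' \<and> y = y' \<and> d = d'"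
  by (auto simp: lift_def prod_eq_iff)

lemma inj_lift: "inj (lift x y)"
  by (simp add: inj_def lift_eq_iff)

lemma lift_mem_block_edges: "lift x y d \<in> block_edges m \<longleftrightarrow> x \<le> y \<and> d \<in> edges m"
  by (simp add: block_edges_def)

lemma graded_relation_block_edges: "graded_relation (block_edges m) snd"
proof
  show "finite (block_edges m)"
    by (rule finite_subset[of _ "(UNIV \<times> {..m}) \<times> (UNIV \<times> {..m})"])
      (auto simp: block_edges_def edges_def)
  show "trans (block_edges m)" by (rule transI) (auto simp: block_edges_def edges_def)
qed (auto simp: block_edges_def edges_def)

interpretation block_edges: graded_relation "block_edges m" snd for m
  by (rule graded_relation_block_edges)

lemma path_block_edges_le: "path (block_edges m) u p v \<Longrightarrow> fst u \<le> fst v"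
proof (cases "p = []")
  case False
  assume "path (block_edges m) u p v"
  from path_transitive[OF block_edges.trans_R this False] show ?thesis
    by (simp add: block_edges_def)
qed simp

lemma path_within_block:
  "path (block_edges m) (x, i) p (x, j) \<longleftrightarrow> (\<exists>q. p = map (lift x x) q \<and> path (edges m) i q j)"
proof (induction p arbitrary: i)
  case Nil
  show ?case by auto
next
  case (Cons d p)
  obtain z k y l where d: "d = ((z, k), (y, l))" by (metis surj_pair)
  show ?case
  proof
    assume path: "path (block_edges m) (x, i) (d # p) (x, j)"
    then have p: "path (block_edges m) (y, l) p (x, j)" and zk: "z = x" "k = i"
      and e: "x \<le> y" "(i, l) \<in> edges m"
      by (auto simp: d block_edges_def)
    have "y \<le> x" using path_block_edges_le[OF p] by simp
    with e(1) have y: "y = x" by (rule antisym[rotated])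
    with p Cons.IH obtain q where "p = map (lift x x) q" "path (edges m) l q j" by blast
    then have "d # p = map (lift x x) ((i, l) # q) \<and> path (edges m) i ((i, l) # q) j"
      using e zk y by (simp add: d lift_def)
    then show "\<exists>q. d # p = map (lift x x) q \<and> path (edges m) i q j" by (rule exI)
  next
    assume "\<exists>q. d # p = map (lift x x) q \<and> path (edges m) i q j"
    then obtain d' q where "d = lift x x d'" "p = map (lift x x) q" "path (edges m) i (d' # q) j"
      by (auto simp: Cons_eq_map_conv)
    then show "path (block_edges m) (x, i) (d # p) (x, j)"
      using Cons.IH[of "snd d'"] by (auto simp: lift_def block_edges_def)
  qed
qed

text \<open>
  There is no way back from the second block, so exactly one edge \<open>d\<close> of the path crosses.
\<close>

lemma path_across_blocks:
  "path (block_edges m) (False, i) p (True, j) \<longleftrightarrow>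
    (\<exists>q d q'. p = map (lift False False) q @ lift False True d # map (lift True True) q' \<and>
      path (edges m) i (q @ d # q') j)"
proof (induction p arbitrary: i)
  case Nil
  show ?case by auto
next
  case (Cons d p)
  obtain z k y l where d: "d = ((z, k), (y, l))" by (metis surj_pair)
  show ?case
  proof
    assume path: "path (block_edges m) (False, i) (d # p) (True, j)"
    then have p: "path (block_edges m) (y, l) p (True, j)" and zk: "z = False" "k = i"
      and e: "(i, l) \<in> edges m"
      by (auto simp: d block_edges_def)
    show "\<exists>q d' q'. d # p = map (lift False False) q @ lift False True d' # map (lift True True) q' \<and>
      path (edges m) i (q @ d' # q') j"
    proof (cases y)
      case True
      with p obtain q' where "p = map (lift True True) q'" "path (edges m) l q' j"
        using path_within_block[of m True l p j] by auto
      then have "d # p = map (lift False False) [] @ lift False True (i, l) # map (lift True True) q' \<and>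
          path (edges m) i ([] @ (i, l) # q') j"
        using e zk True by (simp add: d lift_def)
      then show ?thesis by (intro exI)
    next
      case False
      with p have "path (block_edges m) (False, l) p (True, j)" by simp
      with Cons.IH obtain q d' q' where
        "p = map (lift False False) q @ lift False True d' # map (lift True True) q'"
        "path (edges m) l (q @ d' # q') j"
        by blast
      then have "d # p = map (lift False False) ((i, l) # q) @
            lift False True d' # map (lift True True) q' \<and>
          path (edges m) i (((i, l) # q) @ d' # q') j"
        using e zk False by (simp add: d lift_def)
      then show ?thesis by (intro exI)
    qed
  next
    assume "\<exists>q d' q'. d # p = map (lift False False) q @ lift False True d' # map (lift True True) q' \<and>
      path (edges m) i (q @ d' # q') j"
    then obtain q d' q' where
      dp: "d # p = map (lift False False) q @ lift False True d' # map (lift True True) q'"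
      and path: "path (edges m) i (q @ d' # q') j" by blast
    show "path (block_edges m) (False, i) (d # p) (True, j)"
    proof (cases q)
      case Nil
      with dp path have "d = lift False True d'" "p = map (lift True True) q'"
        "d' \<in> edges m" "fst d' = i" "path (edges m) (snd d') q' j" by auto
      then show ?thesis
        using path_within_block[of m True "snd d'" p j] by (auto simp: lift_mem_block_edges)
    next
      case q: (Cons d'' q'')
      with dp path have d: "d = lift False False d''"
        and p: "p = map (lift False False) q'' @ lift False True d' # map (lift True True) q'"
        and "d'' \<in> edges m" "fst d'' = i" and path': "path (edges m) (snd d'') (q'' @ d' # q') j"
        by auto
      moreover have "path (block_edges m) (False, snd d'') p (True, j)"
        unfolding Cons.IH using p path' by blast
      ultimately show ?thesis by (simp add: lift_mem_block_edges)
    qed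
  qed
qed

lemma path_sum_within_block:
  "path_sum (block_edges m) \<phi> G (lift x x e) = path_sum (edges m) \<phi> (G \<circ> lift x x) e"
proof -
  have "paths (block_edges m) (lift x x e) = map (lift x x) ` paths (edges m) e"
    by (auto simp: paths_def path_within_block)
  then show ?thesis
    unfolding path_sum_def
    by (simp add: sum.reindex inj_on_def inj_map_eq_map[OF inj_lift])
qed

lemma inj_lift_split:
  "inj_on (\<lambda>(q, d, q'). map (lift False False) q @ lift False True d # map (lift True True) q') S"
proof -
  have *: "q1 = q2 \<and> d1 = d2 \<and> q1' = q2'"
    if "map (lift False False) q1 @ lift False True d1 # map (lift True True) q1' =
      map (lift False False) q2 @ lift False True d2 # map (lift True True) q2'" for q1 d1 q1' q2 d2 q2'
    using that
  proof (induction q1 arbitrary: q2)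
    case Nil
    then show ?case
      by (cases q2) (auto simp: lift_eq_iff inj_map_eq_map[OF inj_lift])
  next
    case (Cons e q1)
    then show ?case
      by (cases q2) (auto simp: lift_eq_iff)
  qed
  show ?thesis
  proof (rule inj_onI)
    fix x y
    assume eq: "(case x of (q, d, q') \<Rightarrow> map (lift False False) q @ lift False True d # map (lift True True) q') =
      (case y of (q, d, q') \<Rightarrow> map (lift False False) q @ lift False True d # map (lift True True) q')"
    obtain q1 d1 q1' q2 d2 q2' where x: "x = (q1, d1, q1')" and y: "y = (q2, d2, q2')"
      by (cases x, cases y)
    show "x = y" using *[of q1 d1 q1' q2 d2 q2'] eq unfolding x y prod.case by blast
  qed
qed

lemma path_sum_across_blocks:
  "path_sum (block_edges m) \<phi> G (lift False True e) =
    split_sum (edges m) \<phi> (G \<circ> lift False False) (G \<circ> lift False True) (G \<circ> lift True True) e"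
proof -
  let ?j = "\<lambda>(q, d, q'). map (lift False False) q @ lift False True d # map (lift True True) q'"
  have "paths (block_edges m) (lift False True e) = ?j ` splits (edges m) e"
  proof (intro set_eqI iffI)
    fix p assume "p \<in> paths (block_edges m) (lift False True e)"
    then have "path (block_edges m) (False, fst e) p (True, snd e)" by (simp add: paths_def)
    then obtain q d q' where
      "p = map (lift False False) q @ lift False True d # map (lift True True) q'"
      "path (edges m) (fst e) (q @ d # q') (snd e)"
      unfolding path_across_blocks by blast
    then have "(q, d, q') \<in> splits (edges m) e" "p = ?j (q, d, q')" by (simp_all add: splits_def)
    then show "p \<in> ?j ` splits (edges m) e" by blast
  next
    fix p assume "p \<in> ?j ` splits (edges m) e"
    then obtain q d q' where
      "p = map (lift False False) q @ lift False True d # map (lift True True) q'"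
      "(q, d, q') \<in> splits (edges m) e"
      by auto
    then have "path (block_edges m) (False, fst e) p (True, snd e)" "p \<noteq> []"
      unfolding path_across_blocks by (auto simp: splits_def simp del: split_paired_Ex)
    then show "p \<in> paths (block_edges m) (lift False True e)" by (simp add: paths_def)
  qed
  then show ?thesis
    unfolding path_sum_def split_sum_def
    by (simp only: sum.reindex[OF inj_lift_split]) (auto intro!: sum.cong)
qed

text \<open>
  The corner position \<open>(0, m)\<close> of a diagonal block cannot occur: the path also has an edge between the
  blocks, before or after the marked edge, and no index is smaller than \<open>0\<close> or larger than \<open>m\<close>.
\<close>

lemma splits_diagonal_block:
  assumes "(p, d, q) \<in> splits (block_edges m) (lift False True e)" "fst (fst d) = fst (snd d)"
  shows "(snd (fst d), snd (snd d)) \<in> edges m - {(0, m)}"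
proof -
  have p: "path (block_edges m) (False, fst e) p (fst d)" and d: "d \<in> block_edges m"
    and q: "path (block_edges m) (snd d) q (True, snd e)"
    using assms(1) by (auto simp: splits_def path_append)
  have "(snd (fst d), snd (snd d)) \<noteq> (0, m)"
  proof (cases "fst (fst d)")
    case True
    then have "p \<noteq> []" using p by (auto simp: prod_eq_iff)
    from path_transitive[OF block_edges.trans_R p this] have "0 < snd (fst d)"
      by (auto simp: block_edges_def edges_def)
    then show ?thesis by simp
  next
    case False
    then have "q \<noteq> []" using q assms(2) by (auto simp: prod_eq_iff)
    from path_transitive[OF block_edges.trans_R q this] have "snd (snd d) < m"
      by (auto simp: block_edges_def edges_def)
    then show ?thesis by simp
  qed
  then show ?thesis using d by (simp add: block_edges_def)
qed

text \<open>
  Marked edges inside a diagonal block contribute zero, so only the marked edges that are themselves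
  the crossing edge remain.
\<close>

lemma split_sum_across_blocks:
  assumes \<phi>: "multiadditive \<phi>"
    and D: "\<And>x d. d \<in> edges m - {(0, m)} \<Longrightarrow> D (lift x x d) = 0"
  shows "split_sum (block_edges m) \<phi> G D G' (lift False True e) =
    split_sum (edges m) \<phi> (G \<circ> lift False False) (D \<circ> lift False True) (G' \<circ> lift True True) e"
proof -
  let ?j = "\<lambda>(q, d, q'). (map (lift False False) q, lift False True d, map (lift True True) q')"
  let ?S = "splits (edges m) e" and ?T = "splits (block_edges m) (lift False True e)"
  let ?h = "\<lambda>(p, d, q). \<phi> (map G p @ D d # map G' q)"
  have inj: "inj_on ?j ?S"
    by (auto simp: inj_on_def inj_map_eq_map[OF inj_lift] inj_eq[OF inj_lift])
  have sub: "?j ` ?S \<subseteq> ?T"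
  proof
    fix x assume "x \<in> ?j ` ?S"
    then obtain p d q where x: "x = ?j (p, d, q)" and "(p, d, q) \<in> ?S" by auto
    then have "path (block_edges m) (False, fst e)
        (map (lift False False) p @ lift False True d # map (lift True True) q) (True, snd e)"
      unfolding path_across_blocks by (auto simp: splits_def simp del: split_paired_Ex)
    then show "x \<in> ?T" by (simp add: x splits_def)
  qed
  have zero: "?h x = 0" if "x \<in> ?T - ?j ` ?S" for x
  proof -
    obtain p d q where x: "x = (p, d, q)" by (cases x)
    have mem: "(p, d, q) \<in> ?T" using that x by blast
    obtain z k y l where d: "d = ((z, k), (y, l))" by (metis surj_pair)
    have p: "path (block_edges m) (False, fst e) p (z, k)" and zy: "z \<le> y" "(k, l) \<in> edges m"
      and q: "path (block_edges m) (y, l) q (True, snd e)"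
      using mem by (auto simp: splits_def path_append lift_def d block_edges_def)
    have "z = y"
    proof (rule ccontr)
      assume "z \<noteq> y"
      then have z: "z = False" and y: "y = True" using zy(1) by auto
      obtain p' where p': "p = map (lift False False) p'" "path (edges m) (fst e) p' k"
        using p path_within_block unfolding z by blast
      obtain q' where q': "q = map (lift True True) q'" "path (edges m) l q' (snd e)"
        using q path_within_block unfolding y by blast
      have "(p', (k, l), q') \<in> ?S" using p' q' zy(2) by (auto simp: splits_def path_append)
      then have "?j (p', (k, l), q') \<in> ?j ` ?S" by (rule imageI)
      moreover have "?j (p', (k, l), q') = x" using p' q' by (simp add: x d z y lift_def)
      ultimately show False using that by (metis DiffD2)
    qed
    then have "D d = 0"
      using D[of "(k, l)" z] splits_diagonal_block[OF mem] by (simp add: d lift_def)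
    then show ?thesis by (simp add: x multiadditive_zero[OF \<phi>])
  qed
  have "sum ?h ?T = sum ?h (?j ` ?S)"
    by (rule sum.mono_neutral_right[OF block_edges.finite_splits sub]) (use zero in blast)
  also have "\<dots> = (\<Sum>(p, d, q)\<in>?S.
      \<phi> (map (G \<circ> lift False False) p @ (D \<circ> lift False True) d # map (G' \<circ> lift True True) q))"
    unfolding sum.reindex[OF inj] by (auto intro!: sum.cong)
  finally show ?thesis by (simp only: split_sum_def)
qed

section \<open>The corner entry\<close>

text \<open>No increasing path within \<open>0, \<dots>, m\<close> properly extends the edge from \<open>0\<close> to \<open>m\<close>.\<close>

lemma splits_corner:
  assumes "(p, (0, m), q) \<in> splits (edges m) e"
  shows "p = [] \<and> q = [] \<and> e = (0, m)"
proof -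
  have p: "path (edges m) (fst e) p 0" and q: "path (edges m) m q (snd e)"
    using assms by (auto simp: splits_def path_append)
  have "p = []" using path_transitive[OF edges.trans_R p] by (auto simp: edges_def)
  moreover have "q = []"
    by (rule ccontr) (use path_transitive[OF edges.trans_R q] in \<open>auto simp: edges_def\<close>)
  ultimately show ?thesis using p q by (simp add: prod_eq_iff)
qed

lemma split_sum_concentrated:
  assumes \<phi>: "multiadditive \<phi>" and D: "\<And>d. d \<in> edges m - {(0, m)} \<Longrightarrow> D d = 0"
    and e: "e \<in> edges m"
  shows "split_sum (edges m) \<phi> E D E' e = \<phi> [D e]"
proof -
  let ?h = "\<lambda>(p, d, q). \<phi> (map E p @ D d # map E' q)"
  have zero: "?h x = 0" if "x \<in> splits (edges m) e" "x \<noteq> ([], e, [])" for x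
  proof -
    obtain p d q where x: "x = (p, d, q)" by (cases x)
    have "d \<in> edges m - {(0, m)}"
      using that splits_corner[of p m q e] edges.splits_mem[of p d q m e] by (auto simp: x)
    then show ?thesis using D by (simp add: x multiadditive_zero[OF \<phi>])
  qed
  have "([], e, []) \<in> splits (edges m) e" using e by (simp add: splits_def)
  then have "sum ?h (splits (edges m) e) = sum ?h {([], e, [])}"
    by (intro sum.mono_neutral_right) (use zero edges.finite_splits in auto)
  then show ?thesis by (simp add: split_sum_def)
qed

lemma split_sum_cong:
  assumes "e \<noteq> (0, m)" "\<And>d. d \<in> edges m - {(0, m)} \<Longrightarrow> D d = D' d"
  shows "split_sum (edges m) \<phi> E D E' e = split_sum (edges m) \<phi> E D' E' e"
proof -
  have "D d = D' d" if "(p, d, q) \<in> splits (edges m) e" for p d q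
  proof -
    have "d \<noteq> (0, m)" using that splits_corner assms(1) by blast
    then show ?thesis using assms(2) edges.splits_mem[OF that] by blast
  qed
  then show ?thesis unfolding split_sum_def by (auto intro!: sum.cong)
qed

section \<open>Induced maps on cohomology\<close>

text \<open>
  The image of the class of a cocycle \<open>z\<close> is the class of \<open>f\<^sub>1 z\<close>, by the usual argument: \<open>f\<^sub>1\<close> is
  additive and sends coboundaries to coboundaries.
\<close>

lemma cohom_map_class:
  assumes bA: "multiadditive bA" and b: "multiadditive bB" and f: "multiadditive f"
    and chain: "\<And>x. bB [f [x]] = f [bA [x]]"
    and \<alpha>: "\<alpha> \<in> cohomology bA" and x: "x \<in> \<alpha>"
  shows "cohom_map bB f \<alpha> \<in> cohomology bB \<and> f [x] \<in> cohom_map bB f \<alpha>"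
proof -
  have badd: "bB [u + v] = bB [u] + bB [v]" for u v
    using multiadditive_add[OF b, of "[]" u v "[]"] by simp
  have b0: "bB [0] = 0" using badd[of 0 0] by simp
  have fdiff: "f [u - v] = f [u] - f [v]" for u v
    using multiadditive_diff[OF f, of "[]" u v "[]"] by simp
  have f0: "f [0] = 0" using fdiff[of 0 0] by simp
  obtain z where z: "bA [z] = 0" and \<alpha>z: "\<alpha> = cohom_rel bA `` {z}"
    using \<alpha> by (auto simp: cohomology_def quotient_def)
  have closed: "bB [f [y]] = 0" and bound: "\<exists>w. f [y] - f [z] = bB [w]" if "y \<in> \<alpha>" for y
  proof -
    from that obtain u where u: "bA [y] = 0" "y - z = bA [u]"
      by (auto simp: \<alpha>z cohom_rel_def)
    show "bB [f [y]] = 0" by (simp add: chain u f0)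
    show "\<exists>w. f [y] - f [z] = bB [w]" by (metis u(2) chain fdiff)
  qed
  have fz: "bB [f [z]] = 0" by (simp add: chain z f0)
  have mem: "v \<in> cohom_map bB f \<alpha> \<longleftrightarrow> (\<exists>y\<in>\<alpha>. bB [v] = 0 \<and> (\<exists>w. v - f [y] = bB [w]))" for v
    using closed by (auto simp: cohom_map_def cohom_rel_def)
  have fx: "f [x] \<in> cohom_map bB f \<alpha>"
    unfolding mem using x closed[OF x] b0 by (metis diff_self)
  have "v \<in> cohom_rel bB `` {f [z]}" if v: "v \<in> cohom_map bB f \<alpha>" for v
  proof -
    from v obtain y w where "y \<in> \<alpha>" and vb: "bB [v] = 0" and w: "v - f [y] = bB [w]"
      unfolding mem by blast
    then obtain w' where w': "f [y] - f [z] = bB [w']" using bound by blast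
    have "v - f [z] = bB [w + w']" unfolding badd w[symmetric] w'[symmetric] by simp
    then show ?thesis using vb fz by (auto simp: cohom_rel_def)
  qed
  moreover have "v \<in> cohom_map bB f \<alpha>" if "v \<in> cohom_rel bB `` {f [z]}" for v
  proof -
    have "z - z = bA [0]" using multiadditive_zero[OF bA, of "[]" "[]"] by simp
    then have "z \<in> \<alpha>" using z by (auto simp: \<alpha>z cohom_rel_def)
    then show ?thesis using that unfolding mem by (auto simp: cohom_rel_def)
  qed
  ultimately have "cohom_map bB f \<alpha> = cohom_rel bB `` {f [z]}" by blast
  then show ?thesis using fx fz by (auto simp: cohomology_def quotient_def)
qed


section \<open>Images of defining systems\<close>

context A_infinity_morphism
begin

lemma multiadditive_maps: "multiadditive f" "multiadditive bA" "multiadditive bB"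
  using f_multilinear A.b_multilinear B.b_multilinear by (simp_all add: multilinear_imp_multiadditive)

text \<open>The morphism relation for words of length 1, where \<open>[1]\<close> is the only composition.\<close>

lemma f_chain_map: "bB [f [x]] = f [bA [x]]"
proof -
  have "{(r, s, t). r + s + t = length [x] \<and> 1 \<le> s} = {(0, 1, 0)}" by auto
  then have "bar_insertion_sum (bar VA) f bA [x] = f [bA [x]]"
    by (simp add: bar_insertion_sum_def)
  moreover have "compositions (length [x]) = {[1]}"
  proof (intro equalityI subsetI)
    fix ns assume ns: "ns \<in> compositions (length [x])"
    then obtain k ks where "ns = k # ks" by (cases ns) (auto simp: compositions_def)
    with ns show "ns \<in> {[1]}" by (cases ks) (auto simp: compositions_def)
  qed (simp add: compositions_def)
  ultimately show ?thesis using f_relation_bar[of "[x]"] by simp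
qed

lemma f_zero: "f [0] = 0"
  using multiadditive_zero[OF multiadditive_maps(1), of "[]" "[]"] by simp

lemma F_mat_eq:
  assumes "a \<in> Mat_plus m"
  shows "F_mat m f a = curry (path_sum (edges m) f (case_prod a))"
  using power_sum_eq_path_sum[OF multiadditive_maps(1) assms] by (simp add: F_mat_def)

lemma F_mat_mem: "a \<in> Mat_plus m \<Longrightarrow> F_mat m f a \<in> Mat_plus m"
  by (simp add: F_mat_eq path_sum_mem_Mat_plus)

text \<open>
  In the identity \<open>path_sum_morphism\<close> the marked edge carries a zero label unless it is \<open>(0, m)\<close>, and in that case
  it is the whole path. So for the corner entry only \<open>f\<^sub>1\<close> of the corner label survives, and for every other
  entry both sides vanish.
\<close>

lemma del_F_mat:
  assumes a: "a \<in> Mat_plus m" and del: "approx_mat m (del_mat m bA a) (\<lambda>i j. 0)"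
    and ij: "(i, j) \<in> edges m"
  shows "del_mat m bB (F_mat m f a) i j = f [del_mat m bA a i j]"
proof -
  have dA: "curry (path_sum (edges m) bA (case_prod a)) = del_mat m bA a"
    using power_sum_eq_path_sum[OF multiadditive_maps(2) a] by (simp add: del_mat_def)
  have "path_sum (edges m) bA (case_prod a) d = 0" if "d \<in> edges m - {(0, m)}" for d
    using fun_cong[OF fun_cong[OF dA, of "fst d"], of "snd d"] that del
    by (cases d) (auto simp: approx_mat_def edges_def)
  then have "split_sum (edges m) f (bar VA \<circ> case_prod a) (path_sum (edges m) bA (case_prod a))
      (case_prod a) (i, j) = f [path_sum (edges m) bA (case_prod a) (i, j)]"
    by (rule split_sum_concentrated[OF multiadditive_maps(1) _ ij])
  moreover have "del_mat m bB (F_mat m f a) i j =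
      path_sum (edges m) bB (path_sum (edges m) f (case_prod a)) (i, j)"
    using power_sum_eq_path_sum[OF multiadditive_maps(3) F_mat_mem[OF a]]
    by (simp add: del_mat_def F_mat_eq[OF a])
  ultimately show ?thesis
    using path_sum_morphism[OF graded_relation_edges] by (simp flip: dA)
qed

lemma F_mat_defining_system:
  assumes "defining_system m bA \<alpha> a"
  shows "defining_system m bB (\<lambda>i. cohom_map bB f (\<alpha> i)) (F_mat m f a)"
proof -
  have a: "a \<in> Mat_plus m" and del: "approx_mat m (del_mat m bA a) (\<lambda>i j. 0)"
    and cls: "\<And>i. i \<in> {1..m} \<Longrightarrow> \<alpha> i \<in> cohomology bA \<and> a (i - 1) i \<in> \<alpha> i"
    using assms by (auto simp: defining_system_def)
  have "del_mat m bB (F_mat m f a) i j = 0" if "i \<le> m" "j \<le> m" "(i, j) \<noteq> (0, m)" for i j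
  proof (cases "(i, j) \<in> edges m")
    case True
    have "del_mat m bA a i j = 0" using del that unfolding approx_mat_def by blast
    then show ?thesis using del_F_mat[OF a del True] by (simp add: f_zero)
  next
    case False
    then show ?thesis
      using power_sum_eq_path_sum[OF multiadditive_maps(3) F_mat_mem[OF a]]
      by (simp add: del_mat_def path_sum_def paths_edges)
  qed
  then have "approx_mat m (del_mat m bB (F_mat m f a)) (\<lambda>i j. 0)" by (simp add: approx_mat_def)
  moreover have "F_mat m f a (i - 1) i = f [a (i - 1) i]" if i: "i \<in> {1..m}" for i
  proof -
    have "paths (edges m) (i - 1, i) = {[(i - 1, i)]}"
    proof (intro equalityI subsetI)
      fix p assume p: "p \<in> paths (edges m) (i - 1, i)"
      then have "length p + (i - 1) \<le> i" using edges.length_path_le[of m "i - 1" p i]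
        by (simp add: paths_def)
      with p i obtain d where "p = [d]" by (cases p) (auto simp: paths_def)
      with p show "p \<in> {[(i - 1, i)]}" by (auto simp: paths_def prod_eq_iff)
    qed (use i in \<open>auto simp: paths_def edges_def\<close>)
    then show ?thesis by (simp add: F_mat_eq[OF a] path_sum_def)
  qed
  moreover have "cohom_map bB f (\<alpha> i) \<in> cohomology bB \<and> f [a (i - 1) i] \<in> cohom_map bB f (\<alpha> i)"
    if i: "i \<in> {1..m}" for i
    using cls[OF i] by (intro cohom_map_class[OF multiadditive_maps(2,3,1) f_chain_map]) auto
  ultimately show ?thesis
    using F_mat_mem[OF a] by (simp add: defining_system_def)
qed

lemma bar_F_mat:
  assumes a: "a \<in> Mat_plus m"
  shows "case_prod (bar_mat VB (F_mat m f a)) = path_sum (edges m) f (case_prod (bar_mat VA a))"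
proof
  fix e :: "nat \<times> nat"
  have "bar VB (f (map (case_prod a) p)) = f (map (case_prod (bar_mat VA a)) p)" if "p \<noteq> []" for p
  proof -
    have map: "map (case_prod (bar_mat VA a)) p = map (bar VA) (map (case_prod a) p)"
      by (simp add: bar_mat_def split_beta)
    have "f (map (bar VA) (map (case_prod a) p)) = sign_act (0::'g) (bar VB (f (map (case_prod a) p)))"
      by (rule bar_of_degree[OF A.graded_vector_space_axioms B.graded_vector_space_axioms
          multiadditive_maps(1) f_degree]) (simp add: that)
    then show ?thesis by (simp only: map sign_act_0)
  qed
  then show "case_prod (bar_mat VB (F_mat m f a)) e = path_sum (edges m) f (case_prod (bar_mat VA a)) e"
    by (cases e) (auto simp: bar_mat_def F_mat_eq[OF a] path_sum_def B.bar_sum paths_def intro!: sum.cong)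
qed

lemma bar_mat_mem: "a \<in> Mat_plus m \<Longrightarrow> bar_mat VA a \<in> Mat_plus m"
  by (simp add: Mat_plus_def bar_mat_def A.bar_zero)

text \<open>
  The identity \<open>path_sum_morphism\<close> for the block matrix \<open>X\<close> with diagonal blocks \<open>G = bar a'\<close> and \<open>E = a\<close> and
  off-diagonal block \<open>H = c\<close>, read off between the blocks. The bars in the first block
  cancel, which is why \<open>f\<close> is applied to words in \<open>a'\<close> followed by words in \<open>a\<close> and the sum telescopes.
\<close>

lemma F_mat_equivalent:
  assumes "equivalent_defining_systems m VA bA \<alpha> a a'"
  shows "equivalent_defining_systems m VB bB (\<lambda>i. cohom_map bB f (\<alpha> i)) (F_mat m f a) (F_mat m f a')"
proof -
  have ds: "defining_system m bA \<alpha> a" "defining_system m bA \<alpha> a'"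
    using assms by (auto simp: equivalent_defining_systems_def)
  obtain c where c: "c \<in> Mat_plus m" and diff: "approx_mat m (\<lambda>i j. a' i j - a i j)
      (\<lambda>i j. Sum_any (\<lambda>(r, t).
         on_tensor bA (odots m (replicate r (bar_mat VA a') @ [c] @ replicate t a)) i j))"
    using assms unfolding equivalent_defining_systems_def by blast
  have a: "a \<in> Mat_plus m" and a': "a' \<in> Mat_plus m"
    and dela: "approx_mat m (del_mat m bA a) (\<lambda>i j. 0)"
    and dela': "approx_mat m (del_mat m bA a') (\<lambda>i j. 0)"
    using ds by (auto simp: defining_system_def)
  note f = multiadditive_maps(1) and bA = multiadditive_maps(2) and bB = multiadditive_maps(3)
  define E where "E = case_prod a"
  define E' where "E' = case_prod a'"
  define G where "G = case_prod (bar_mat VA a')"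
  define H where "H = case_prod c"
  have barG: "bar VA \<circ> G = E'" and G_eq: "G = bar VA \<circ> E'"
    by (auto simp: G_def E'_def bar_mat_def A.bar_bar)
  define X where "X = block_matrix G H E"
  have X: "X \<circ> lift False False = G" "X \<circ> lift False True = H" "X \<circ> lift True True = E"
    by (simp_all add: X_def)
  have delE: "path_sum (edges m) bA E d = 0" "path_sum (edges m) bA E' d = 0"
    if "d \<in> edges m - {(0, m)}" for d
    using that dela dela' power_sum_eq_path_sum[OF bA a] power_sum_eq_path_sum[OF bA a']
    by (cases d; auto simp: approx_mat_def edges_def del_mat_def E_def E'_def)+
  \<comment> \<open>\<open>b\<close> has degree 1, so \<open>\<partial>\<close> of \<open>bar a'\<close> is \<open>- bar\<close> of \<open>\<partial>\<close> of \<open>a'\<close>.\<close>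
  have delG: "path_sum (edges m) bA G d = 0" if "d \<in> edges m - {(0, m)}" for d
  proof -
    have "bA (map G p) = - bar VA (bA (map E' p))" if "p \<noteq> []" for p
      using bar_of_degree[OF A.graded_vector_space_axioms A.graded_vector_space_axioms
          bA A.b_degree, of "map E' p"] that
      by (simp add: G_eq sign_act_one)
    then have "path_sum (edges m) bA G d = - bar VA (path_sum (edges m) bA E' d)"
      by (auto simp: path_sum_def A.bar_sum paths_def simp flip: sum_negf intro!: sum.cong)
    then show ?thesis using delE(2)[OF that] by (simp add: A.bar_zero)
  qed
  have delX: "path_sum (block_edges m) bA X (lift x x d) = 0" if "d \<in> edges m - {(0, m)}" for x d
    using delE(1)[OF that] delG[OF that] by (cases x) (simp_all add: path_sum_within_block X)
  \<comment> \<open>This is where the assumed equivalence of \<open>a\<close> and \<open>a'\<close> enters.\<close>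
  have cross: "path_sum (block_edges m) bA X (lift False True d) = E' d - E d"
    if "d \<in> edges m - {(0, m)}" for d
  proof -
    obtain k l where d: "d = (k, l)" by (cases d)
    have "E' d - E d = split_sum (edges m) bA G H E d"
      using diff that mixed_power_sum_eq_split_sum[OF bA bar_mat_mem[OF a'] c a, of k l]
      by (auto simp: approx_mat_def edges_def d E_def E'_def G_def H_def)
    then show ?thesis by (simp add: path_sum_across_blocks X)
  qed
  let ?FG = "path_sum (edges m) f G" and ?C = "split_sum (edges m) f G H E"
    and ?FE = "path_sum (edges m) f E"
  have FX: "path_sum (block_edges m) f X \<circ> lift False False = ?FG"
    "path_sum (block_edges m) f X \<circ> lift False True = ?C"
    "path_sum (block_edges m) f X \<circ> lift True True = ?FE"
    by (simp_all add: fun_eq_iff path_sum_within_block path_sum_across_blocks X)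
  have main: "path_sum (edges m) f E' e - ?FE e = split_sum (edges m) bB ?FG ?C ?FE e"
    if "e \<noteq> (0, m)" for e
  proof -
    have "split_sum (edges m) bB ?FG ?C ?FE e =
        path_sum (block_edges m) bB (path_sum (block_edges m) f X) (lift False True e)"
      by (simp add: path_sum_across_blocks FX)
    also have "\<dots> = split_sum (block_edges m) f (bar VA \<circ> X) (path_sum (block_edges m) bA X) X
        (lift False True e)"
      by (rule path_sum_morphism[OF graded_relation_block_edges])
    also have "\<dots> = split_sum (edges m) f (bar VA \<circ> X \<circ> lift False False)
        (path_sum (block_edges m) bA X \<circ> lift False True) (X \<circ> lift True True) e"
      by (rule split_sum_across_blocks[OF f]) (rule delX)
    also have "\<dots> = split_sum (edges m) f E' (path_sum (block_edges m) bA X \<circ> lift False True) E e"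
      by (simp only: comp_assoc X barG)
    also have "\<dots> = split_sum (edges m) f E' (\<lambda>d. E' d - E d) E e"
      by (rule split_sum_cong[OF that]) (simp add: cross)
    also have "\<dots> = path_sum (edges m) f E' e - ?FE e"
      by (rule edges.split_sum_telescope[OF f])
    finally show ?thesis by simp
  qed
  have C: "curry ?C \<in> Mat_plus m" by (rule split_sum_mem_Mat_plus)
  have mem: "bar_mat VB (F_mat m f a') \<in> Mat_plus m"
    using path_sum_mem_Mat_plus[of m f G] bar_F_mat[OF a'] by (metis G_def curry_case_prod)
  have "approx_mat m (\<lambda>i j. F_mat m f a' i j - F_mat m f a i j)
      (\<lambda>i j. Sum_any (\<lambda>(r, t). on_tensor bB (odots m
         (replicate r (bar_mat VB (F_mat m f a')) @ [curry ?C] @ replicate t (F_mat m f a))) i j))"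
    unfolding approx_mat_def mixed_power_sum_eq_split_sum[OF bB mem C F_mat_mem[OF a]] bar_F_mat[OF a']
    using main by (simp add: F_mat_eq[OF a] F_mat_eq[OF a'] G_def E_def E'_def)
  then show ?thesis
    unfolding equivalent_defining_systems_def
    using C F_mat_defining_system[OF ds(1)] F_mat_defining_system[OF ds(2)] by blast
qed

end

theorem theorem4p15:
  fixes scaleA :: "'k::field \<Rightarrow> 'a::ab_group_add \<Rightarrow> 'a"
    and VA :: "'g::grading_group \<Rightarrow> 'a set"
    and bA :: "'a list \<Rightarrow> 'a"
    and scaleB :: "'k \<Rightarrow> 'b::ab_group_add \<Rightarrow> 'b"
    and VB :: "'g \<Rightarrow> 'b set"
    and bB :: "'b list \<Rightarrow> 'b"
    and f :: "'a list \<Rightarrow> 'b"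
    and m :: nat
  assumes "A_infinity_morphism scaleA VA bA scaleB VB bB f"
    and "m \<ge> 2"
  shows "(\<forall>\<alpha> a. defining_system m bA \<alpha> a \<longrightarrow>
            defining_system m bB (\<lambda>i. cohom_map bB f (\<alpha> i)) (F_mat m f a) \<and>
            mu m bB (F_mat m f a) = f [mu m bA a])
       \<and> (\<forall>\<alpha> a a'. equivalent_defining_systems m VA bA \<alpha> a a' \<longrightarrow>
            equivalent_defining_systems m VB bB (\<lambda>i. cohom_map bB f (\<alpha> i))
              (F_mat m f a) (F_mat m f a'))"
proof -
  interpret A_infinity_morphism scaleA VA bA scaleB VB bB f by fact
  have corner: "(0, m) \<in> edges m" using \<open>m \<ge> 2\<close> by (simp add: edges_def)
  have "mu m bB (F_mat m f a) = f [mu m bA a]" if "defining_system m bA \<alpha> a" for \<alpha> a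
    using that del_F_mat[OF _ _ corner] by (simp add: mu_def defining_system_def)
  then show ?thesis using F_mat_defining_system F_mat_equivalent by blast
qed

end
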